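(* Let $AX=B$, where $A\in\mathbb{R}^{n\times n}$ is a nonsingular $\{1;1\}$-quasiseparable matrix, $B=\sum_{k=1}^M\omega_k^BS_k\in\mathbb{R}^{n\times m}$ has a sparse representation with parameter vector $\Omega_B=(\omega_1^B,\dots,\omega_M^B)$, and all entries of $X\in\mathbb{R}^{n\times m}$ are nonzero. Let $\Omega_{QS}$ be a quasiseparable representation of $A$. Then $$\mathscr{K}_{|\Omega_{QS}|,|\Omega_B|}(A(\Omega_{QS}),B(\Omega_B))\le n\,\mathscr{K}_{|A|,|\Omega_B|}(A,B(\Omega_B)).$$
   Context: Let $n\ge2$. A quasiseparable representation of a $\{1;1\}$-quasiseparable matrix $A\in\mathbb{R}^{n\times n}$ is a vector of $7n-8$ real parameters $\Omega_{QS}=(\{p_i\}_{i=2}^n,\{a_i\}_{i=2}^{n-1},\{q_i\}_{i=1}^{n-1},\{d_i\}_{i=1}^n,\{g_i\}_{i=1}^{n-1},\{b_i\}_{i=2}^{n-1},\{h_i\}_{i=2}^n)$ with $A(i,i)=d_i$, $A(i,j)=p_ia_{i-1}a_{i-2}\cdots a_{j+1}q_j$ for $i>j$, and $A(i,j)=g_ib_{i+1}b_{i+2}\cdots b_{j-1}h_j$ for $i<j$ (empty products equal 1); $A$ is $\{1;1\}$-quasiseparable if and only if it has such a representation. Sparse representation of $B$: $B=\sum_{k=1}^M\omega_k^BS_k$, where the $S_k\in\mathbb{R}^{n\times m}$ are fixed constant matrices (typically with entries 0 and 1) and $\Omega_B=(\omega^B_1,\dots,\omega^B_M)$ are independent real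 parameters, independent of the parameters (or entries) of $A$. $|Z|$ denotes the entrywise absolute value, $\|Z\|_{\max}=\max_{i,j}|z_{ij}|$, inequalities are entrywise. Condition numbers (with $\eta>0$): $$\mathscr{K}_{|\Omega_{QS}|,|\Omega_B|}(A(\Omega_{QS}),B(\Omega_B)):=\lim_{\eta\to0}\sup\left\{\frac1\eta\frac{\|\delta X\|_{\max}}{\|X\|_{\max}}: A(\Omega_{QS}+\delta\Omega_{QS})(X+\delta X)=B(\Omega_B+\delta\Omega_B),\ |\delta\Omega_{QS}|\le\eta|\Omega_{QS}|,\ |\delta\Omega_B|\le\eta|\Omega_B|\right\},$$ $$\mathscr{K}_{|A|,|\Omega_B|}(A,B(\Omega_B)):=\lim_{\eta\to0}\sup\left\{\frac1\eta\frac{\|\delta X\|_{\max}}{\|X\|_{\max}}: (A+\delta A)(X+\delta X)=B(\Omega_B+\delta\Omega_B),\ |\delta A|\le\eta|A|,\ |\delta\Omega_B|\le\eta|\Omega_B|\right\}.$$ *)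

theory Defs
  imports "Jordan_Normal_Form.Determinant" "HOL-Library.Extended_Real"
begin

text \<open>
  Vectors of parameters are functions of which only the values on a finite index set matter.
  Generators and weights keep their customary indices starting from 1, whereas the entries of
  the type \<open>mat\<close> are indexed from 0.
\<close>

datatype qs_index =
  QS_p nat | QS_a nat | QS_q nat | QS_d nat | QS_g nat | QS_b nat | QS_h nat

definition qs_indices :: "nat \<Rightarrow> qs_index set" where
  "qs_indices n =
     QS_p ` {2..n} \<union> QS_a ` {2..n-1} \<union> QS_q ` {1..n-1} \<union> QS_d ` {1..n} \<union>
     QS_g ` {1..n-1} \<union> QS_b ` {2..n-1} \<union> QS_h ` {2..n}"

lemma card_qs_indices:
  assumes "n \<ge> 2"
  shows "card (qs_indices n) = 7 * n - 8"
proof -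
  have "card (qs_indices n) =
      card (QS_p ` {2..n}) + card (QS_a ` {2..n-1}) + card (QS_q ` {1..n-1}) +
      card (QS_d ` {1..n}) + card (QS_g ` {1..n-1}) + card (QS_b ` {2..n-1}) +
      card (QS_h ` {2..n})"
    unfolding qs_indices_def
    by (subst card_Un_disjoint, (simp; fail), (simp; fail), (auto; fail))+ simp
  also have "\<dots> = 7 * n - 8"
    using assms by (simp add: card_image inj_on_def)
  finally show ?thesis .
qed

definition qs_entry :: "(qs_index \<Rightarrow> real) \<Rightarrow> nat \<Rightarrow> nat \<Rightarrow> real" where
  "qs_entry \<Omega> i j =
     (if i = j then \<Omega> (QS_d i)
      else if i > j then \<Omega> (QS_p i) * (\<Prod>k\<in>{j<..<i}. \<Omega> (QS_a k)) * \<Omega> (QS_q j)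
      else \<Omega> (QS_g i) * (\<Prod>k\<in>{i<..<j}. \<Omega> (QS_b k)) * \<Omega> (QS_h j))"

definition qs_mat :: "nat \<Rightarrow> (qs_index \<Rightarrow> real) \<Rightarrow> real mat" where
  "qs_mat n \<Omega> = mat n n (\<lambda>(i, j). qs_entry \<Omega> (Suc i) (Suc j))"

definition qs_representation :: "nat \<Rightarrow> real mat \<Rightarrow> (qs_index \<Rightarrow> real) \<Rightarrow> bool" where
  "qs_representation n A \<Omega> \<longleftrightarrow> A = qs_mat n \<Omega>"

definition quasiseparable_1_1 :: "nat \<Rightarrow> real mat \<Rightarrow> bool" where
  "quasiseparable_1_1 n A \<longleftrightarrow> (\<exists>\<Omega>. qs_representation n A \<Omega>)"

definition sparse_mat ::
    "nat \<Rightarrow> nat \<Rightarrow> nat \<Rightarrow> (nat \<Rightarrow> real mat) \<Rightarrow> (nat \<Rightarrow> real) \<Rightarrow> real mat" where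
  "sparse_mat n m M S \<omega> = mat n m (\<lambda>(i, j). \<Sum>k=1..M. \<omega> k * S k $$ (i, j))"

definition max_norm :: "real mat \<Rightarrow> real" where
  "max_norm Z = Max (abs ` elements_mat Z)"

definition rel_bounded :: "'i set \<Rightarrow> real \<Rightarrow> ('i \<Rightarrow> real) \<Rightarrow> ('i \<Rightarrow> real) \<Rightarrow> bool" where
  "rel_bounded I \<eta> \<delta> w \<longleftrightarrow> (\<forall>x\<in>I. \<bar>\<delta> x\<bar> \<le> \<eta> * \<bar>w x\<bar>)"

definition mat_rel_bounded :: "real \<Rightarrow> real mat \<Rightarrow> real mat \<Rightarrow> bool" where
  "mat_rel_bounded \<eta> \<delta>A A \<longleftrightarrow>
     (\<forall>i<dim_row A. \<forall>j<dim_col A. \<bar>\<delta>A $$ (i, j)\<bar> \<le> \<eta> * \<bar>A $$ (i, j)\<bar>)"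

text \<open>
  The suprema are taken in the extended reals, since they may be infinite when \<open>\<eta>\<close> is so large
  that the perturbed coefficient matrix can become singular.  The argument \<open>X\<close> is the solution
  of the unperturbed system.
\<close>

definition cond_qs ::
    "nat \<Rightarrow> nat \<Rightarrow> nat \<Rightarrow> (nat \<Rightarrow> real mat) \<Rightarrow> (qs_index \<Rightarrow> real) \<Rightarrow> (nat \<Rightarrow> real) \<Rightarrow> real mat \<Rightarrow> ereal"
  where
  "cond_qs n m M S \<Omega> \<omega> X =
     Lim (at_right (0::real)) (\<lambda>\<eta>.
       Sup {ereal (1 / \<eta> * (max_norm \<delta>X / max_norm X)) | \<delta>X \<delta>\<Omega> \<delta>\<omega>.
              \<delta>X \<in> carrier_mat n m \<and>
              qs_mat n (\<lambda>x. \<Omega> x + \<delta>\<Omega> x) * (X + \<delta>X) = sparse_mat n m M S (\<lambda>k. \<omega> k + \<delta>\<omega> k) \<and>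
              rel_bounded (qs_indices n) \<eta> \<delta>\<Omega> \<Omega> \<and>
              rel_bounded {1..M} \<eta> \<delta>\<omega> \<omega>})"

definition cond_entrywise ::
    "nat \<Rightarrow> nat \<Rightarrow> nat \<Rightarrow> (nat \<Rightarrow> real mat) \<Rightarrow> real mat \<Rightarrow> (nat \<Rightarrow> real) \<Rightarrow> real mat \<Rightarrow> ereal"
  where
  "cond_entrywise n m M S A \<omega> X =
     Lim (at_right (0::real)) (\<lambda>\<eta>.
       Sup {ereal (1 / \<eta> * (max_norm \<delta>X / max_norm X)) | \<delta>X \<delta>A \<delta>\<omega>.
              \<delta>X \<in> carrier_mat n m \<and> \<delta>A \<in> carrier_mat n n \<and>
              (A + \<delta>A) * (X + \<delta>X) = sparse_mat n m M S (\<lambda>k. \<omega> k + \<delta>\<omega> k) \<and>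
              mat_rel_bounded \<eta> \<delta>A A \<and>
              rel_bounded {1..M} \<eta> \<delta>\<omega> \<omega>})"

end

theory Submission
  imports "HOL-Analysis.Extended_Real_Limits" Defs
begin

text \<open>
  The inequality compares two suprema at different radii.  Every entry of a matrix given by a
  quasiseparable representation is a product of at most \<open>n\<close> of the parameters, so perturbing
  the parameters by a relative amount \<open>\<eta>\<close> perturbs each entry by a relative amount of at most
  \<open>\<eta>' = (1 + \<eta>) ^ n - 1\<close> (\<open>qs_mat_rel_perturbation\<close>).  As \<open>\<eta> \<le> \<eta>'\<close>, the perturbations of the
  right-hand side remain admissible at radius \<open>\<eta>'\<close> too.  Hence every \<open>\<delta>X\<close> that is admissible for
  the quasiseparable problem at radius \<open>\<eta>\<close> is admissible for the entrywise problem at radius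
  \<open>\<eta>'\<close>, and after division by the radii the first supremum is at most \<open>\<eta>' / \<eta>\<close> times the second.
  Now let \<open>\<eta>\<close> tend to 0: then \<open>\<eta>'\<close> tends to 0 as well, and \<open>\<eta>' / \<eta>\<close> tends to \<open>n\<close>.

  This argument needs that both limits exist, since \<open>Lim\<close> is only a definite description.
  Both problems are families of perturbed systems \<open>(A + \<delta>A) (X + D) = A X + \<delta>B\<close> indexed by a
  direction \<open>u\<close>, with \<open>\<delta>A = \<eta> A1 u + O(\<eta>\<^sup>2)\<close> and \<open>\<delta>B = \<eta> B1 u + O(\<eta>\<^sup>2)\<close> uniformly in \<open>u\<close>.  As
  \<open>D = G (\<delta>B - \<delta>A X) - G (\<delta>A D)\<close> with \<open>G = A\<^sup>-\<^sup>1\<close>, the solution satisfies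
  \<open>D = \<eta> G (B1 u - A1 u X) + O(\<eta>\<^sup>2)\<close>, again uniformly in \<open>u\<close>, and the scaled suprema converge to
  the supremum of the directional derivatives (\<open>perturbed_system_limit\<close>).
\<close>

section \<open>The maximum norm of a matrix\<close>

lemma max_norm_le_iff:
  assumes "Z \<in> carrier_mat n m" "0 < n" "0 < m"
  shows "max_norm Z \<le> c \<longleftrightarrow> (\<forall>i<n. \<forall>j<m. \<bar>Z $$ (i, j)\<bar> \<le> c)"
proof -
  have eq: "elements_mat Z = (\<lambda>(i, j). Z $$ (i, j)) ` ({..<n} \<times> {..<m})"
    using assms(1) by (force dest!: elements_matD)
  have "finite (abs ` elements_mat Z)" "abs ` elements_mat Z \<noteq> {}"
    unfolding eq using assms(2,3) by auto
  then show ?thesis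
    unfolding max_norm_def by (subst Max_le_iff) (auto simp: eq)
qed

lemma max_norm_leI:
  assumes "Z \<in> carrier_mat n m" "0 < n" "0 < m"
    and "\<And>i j. i < n \<Longrightarrow> j < m \<Longrightarrow> \<bar>Z $$ (i, j)\<bar> \<le> c"
  shows "max_norm Z \<le> c"
  using assms(4) by (simp add: max_norm_le_iff[OF assms(1-3)])

lemma entry_le_max_norm:
  assumes "Z \<in> carrier_mat n m" "i < n" "j < m"
  shows "\<bar>Z $$ (i, j)\<bar> \<le> max_norm Z"
  using max_norm_le_iff[OF assms(1), of "max_norm Z"] assms by fastforce

lemma max_norm_nonneg:
  assumes "Z \<in> carrier_mat n m" "0 < n" "0 < m"
  shows "0 \<le> max_norm Z"
  using entry_le_max_norm[OF assms] by linarith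

lemma max_norm_add:
  assumes "P \<in> carrier_mat n m" "Q \<in> carrier_mat n m" "0 < n" "0 < m"
  shows "max_norm (P + Q) \<le> max_norm P + max_norm Q"
proof -
  have "P + Q \<in> carrier_mat n m" using assms by simp
  moreover have "\<bar>(P + Q) $$ (i, j)\<bar> \<le> max_norm P + max_norm Q" if "i < n" "j < m" for i j
    using entry_le_max_norm[OF assms(1) that] entry_le_max_norm[OF assms(2) that] that assms
    by simp
  ultimately show ?thesis using assms(3,4) by (intro max_norm_leI[of _ n m])
qed

lemma max_norm_minus:
  assumes "P \<in> carrier_mat n m" "Q \<in> carrier_mat n m" "0 < n" "0 < m"
  shows "max_norm (P - Q) \<le> max_norm P + max_norm Q"
proof -
  have "P - Q \<in> carrier_mat n m" using assms by auto
  moreover have "\<bar>(P - Q) $$ (i, j)\<bar> \<le> max_norm P + max_norm Q" if "i < n" "j < m" for i j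
    using entry_le_max_norm[OF assms(1) that] entry_le_max_norm[OF assms(2) that] that assms
    by simp
  ultimately show ?thesis using assms(3,4) by (intro max_norm_leI[of _ n m])
qed

lemma max_norm_le_diff:
  assumes "P \<in> carrier_mat n m" "Q \<in> carrier_mat n m" "0 < n" "0 < m"
  shows "max_norm P \<le> max_norm Q + max_norm (P - Q)"
proof -
  have "Q + (P - Q) = P" using assms by (intro eq_matI) auto
  then show ?thesis
    using max_norm_add[OF assms(2) minus_carrier_mat[OF assms(2)] assms(3,4), of P] by simp
qed

lemma max_norm_diff_commute:
  assumes "P \<in> carrier_mat n m" "Q \<in> carrier_mat n m" "0 < n" "0 < m"
  shows "max_norm (P - Q) = max_norm (Q - P)"
proof -
  have "max_norm (P - Q) \<le> c \<longleftrightarrow> max_norm (Q - P) \<le> c" for c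
  proof -
    have "P - Q \<in> carrier_mat n m" "Q - P \<in> carrier_mat n m" using assms by auto
    then show ?thesis
      using assms by (auto simp: max_norm_le_iff[of _ n m] abs_minus_commute)
  qed
  from this[of "max_norm (P - Q)"] this[of "max_norm (Q - P)"] show ?thesis by simp
qed

lemma max_norm_smult:
  assumes "P \<in> carrier_mat n m" "0 < n" "0 < m" "0 < k"
  shows "max_norm (k \<cdot>\<^sub>m P) = k * max_norm P"
proof -
  have "max_norm (k \<cdot>\<^sub>m P) \<le> k * c \<longleftrightarrow> max_norm P \<le> c" for c
    using assms by (auto simp: max_norm_le_iff[of _ n m] abs_mult)
  from this[of "max_norm P"] this[of "max_norm (k \<cdot>\<^sub>m P) / k"] show ?thesis
    using assms(4) by (simp add: field_simps)
qed

lemma max_norm_mult: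
  assumes "P \<in> carrier_mat n l" "Q \<in> carrier_mat l m" "0 < n" "0 < m"
  shows "max_norm (P * Q) \<le> real l * max_norm P * max_norm Q"
proof -
  have "\<bar>(P * Q) $$ (i, j)\<bar> \<le> real l * max_norm P * max_norm Q" if ij: "i < n" "j < m" for i j
  proof -
    have "(P * Q) $$ (i, j) = (\<Sum>k<l. P $$ (i, k) * Q $$ (k, j))"
      using ij assms by (simp add: scalar_prod_def lessThan_atLeast0)
    also have "\<bar>\<dots>\<bar> \<le> (\<Sum>k<l. \<bar>P $$ (i, k) * Q $$ (k, j)\<bar>)"
      by (rule sum_abs)
    also have "\<dots> \<le> (\<Sum>k<l. max_norm P * max_norm Q)"
    proof (rule sum_mono)
      fix k assume "k \<in> {..<l}"
      then have "\<bar>P $$ (i, k)\<bar> \<le> max_norm P" "\<bar>Q $$ (k, j)\<bar> \<le> max_norm Q"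
        using entry_le_max_norm assms ij by auto
      then show "\<bar>P $$ (i, k) * Q $$ (k, j)\<bar> \<le> max_norm P * max_norm Q"
        unfolding abs_mult by (intro mult_mono) auto
    qed
    finally show ?thesis by simp
  qed
  moreover have "P * Q \<in> carrier_mat n m" using assms by simp
  ultimately show ?thesis using assms(3,4) by (intro max_norm_leI[of _ n m])
qed

section \<open>First-order expansion of the solution of a perturbed system\<close>

text \<open>
  Multiplying the perturbed system by \<open>G = A\<^sup>-\<^sup>1\<close> separates the part that is linear in the
  perturbations from the term \<open>G (H D)\<close>, which is of second order once \<open>D\<close> is known to be small.
\<close>

lemma perturbed_solution_identity:
  fixes A H G X D F :: "real mat"
  assumes A: "A \<in> carrier_mat n n" and H: "H \<in> carrier_mat n n"
    and G: "G \<in> carrier_mat n n" and GA: "G * A = 1\<^sub>m n"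
    and X: "X \<in> carrier_mat n m" and D: "D \<in> carrier_mat n m" and F: "F \<in> carrier_mat n m"
    and sol: "(A + H) * (X + D) = A * X + F"
  shows "D = G * (F - H * X) - G * (H * D)"
proof -
  have c: "A * X \<in> carrier_mat n m" "A * D \<in> carrier_mat n m"
    "H * X \<in> carrier_mat n m" "H * D \<in> carrier_mat n m"
    using A H X D by auto
  have "(A + H) * (X + D) = (A * X + A * D) + (H * X + H * D)"
    using A H X D
    by (subst add_mult_distrib_mat[of _ n n _ _ m]) (auto simp: mult_add_distrib_mat[of _ n n _ m])
  then have eq: "(A * X + A * D) + (H * X + H * D) = A * X + F"
    using sol by simp
  have AD: "A * D = (F - H * X) - H * D"
  proof (rule eq_matI)
    fix i j
    assume "i < dim_row (F - H * X - H * D)" "j < dim_col (F - H * X - H * D)"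
    then have ij: "i < n" "j < m" using H D by auto
    have "((A * X + A * D) + (H * X + H * D)) $$ (i, j) = (A * X + F) $$ (i, j)"
      using eq by simp
    then show "(A * D) $$ (i, j) = (F - H * X - H * D) $$ (i, j)"
      using ij c F carrier_matD[OF c(1)] carrier_matD[OF c(2)] carrier_matD[OF c(3)]
        carrier_matD[OF c(4)]
      by (simp del: index_mult_mat)
  qed (use A H D in auto)
  have "D = (G * A) * D" using GA D by simp
  also have "\<dots> = G * ((F - H * X) - H * D)"
    using AD G A D by simp
  also have "\<dots> = G * (F - H * X) - G * (H * D)"
    using G F H X D by (intro mult_minus_distrib_mat[of _ n n _ m]) auto
  finally show ?thesis .
qed

text \<open>
  The identity \<open>V = - G (H V)\<close> for \<open>V\<close> in the kernel of \<open>A + H\<close> contradicts the hypothesis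
  unless \<open>V = 0\<close>.
\<close>

lemma perturbed_matrix_right_inverse:
  assumes n: "0 < n" and A: "A \<in> carrier_mat n n" and H: "H \<in> carrier_mat n n"
    and G: "G \<in> carrier_mat n n" and GA: "G * A = 1\<^sub>m n"
    and small: "\<And>V. V \<in> carrier_mat n 1 \<Longrightarrow> max_norm (G * (H * V)) \<le> max_norm V / 2"
  obtains J where "J \<in> carrier_mat n n" "(A + H) * J = 1\<^sub>m n"
proof -
  have AH: "A + H \<in> carrier_mat n n" using A H by simp
  have "det (A + H) \<noteq> 0"
  proof
    assume "det (A + H) = 0"
    then obtain v where v: "v \<in> carrier_vec n" "v \<noteq> 0\<^sub>v n" "(A + H) *\<^sub>v v = 0\<^sub>v n"
      using det_0_iff_vec_prod_zero[OF AH] by blast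
    \<comment> \<open>The kernel vector as a matrix with one column, so that the maximum norm applies.\<close>
    define V where "V = mat n 1 (\<lambda>(i, j). v $ i)"
    have V: "V \<in> carrier_mat n 1" by (simp add: V_def)
    have col: "col V 0 = v" using v(1) by (auto simp: V_def)
    have Z: "0\<^sub>m n 1 \<in> carrier_mat n 1" by simp
    have "(A + H) * V = 0\<^sub>m n 1"
    proof (rule eq_matI)
      fix i j
      assume "i < dim_row (0\<^sub>m n 1 :: real mat)" "j < dim_col (0\<^sub>m n 1 :: real mat)"
      then have ij: "i < n" "j = 0" by auto
      have "((A + H) * V) $$ (i, j) = ((A + H) *\<^sub>v v) $ i"
        using ij carrier_matD[OF AH] carrier_matD[OF V] col by simp
      then show "((A + H) * V) $$ (i, j) = 0\<^sub>m n 1 $$ (i, j)"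
        using v(3) ij by simp
    qed (use AH V in auto)
    then have "(A + H) * (0\<^sub>m n 1 + V) = A * 0\<^sub>m n 1 + 0\<^sub>m n 1"
      using V A by simp
    note identity = perturbed_solution_identity[OF A H G GA Z V Z this]
    have zero: "0\<^sub>m n 1 - 0\<^sub>m n 1 = (0\<^sub>m n 1 :: real mat)"
      by (rule eq_matI) auto
    from identity
    have "V = 0\<^sub>m n 1 - G * (H * V)"
      by (simp only: zero right_mult_zero_mat[OF G] right_mult_zero_mat[OF H])
    then have "max_norm V \<le> max_norm (0\<^sub>m n 1 :: real mat) + max_norm (G * (H * V))"
      using max_norm_minus[of "0\<^sub>m n 1" n 1 "G * (H * V)"] G H V n by simp
    moreover have "max_norm (0\<^sub>m n 1 :: real mat) \<le> 0"
      using n by (simp add: max_norm_le_iff[of _ n 1])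
    ultimately have "max_norm V \<le> 0" using small[OF V] by simp
    then have "v $ i = 0" if "i < n" for i
      using that n V by (simp add: max_norm_le_iff[of _ n 1]) (simp add: V_def)
    then have "v = 0\<^sub>v n" using v(1) by (intro eq_vecI) auto
    with v(2) show False ..
  qed
  from det_non_zero_imp_unit[OF AH this, of "()"]
  show ?thesis using that unfolding Units_def ring_mat_def by auto
qed

text \<open>
  For small \<open>\<eta>\<close> the map \<open>D \<mapsto> G (\<delta>A D)\<close> at least halves norms, so a solution \<open>D\<close> is at most twice as large
  as \<open>G (\<delta>B - \<delta>A X) = O(\<eta>)\<close>; inserting this bound into \<open>G (\<delta>A D)\<close> makes that term \<open>O(\<eta>\<^sup>2)\<close>.
  Solvability is part of the conclusion, since a bound on the solutions alone would allow the
  supremum over them to be too small.  The constants do not depend on the direction \<open>u\<close>.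
\<close>

lemma perturbed_system_first_order:
  fixes \<delta>A \<delta>B :: "real \<Rightarrow> 'u \<Rightarrow> real mat" and A1 B1 :: "'u \<Rightarrow> real mat"
  assumes n: "0 < n" and m: "0 < m"
    and A: "A \<in> carrier_mat n n" and G: "G \<in> carrier_mat n n" and GA: "G * A = 1\<^sub>m n"
    and X: "X \<in> carrier_mat n m"
    and dA: "\<And>\<eta> u. \<delta>A \<eta> u \<in> carrier_mat n n" and dB: "\<And>\<eta> u. \<delta>B \<eta> u \<in> carrier_mat n m"
    and A1: "\<And>u. A1 u \<in> carrier_mat n n" and B1: "\<And>u. B1 u \<in> carrier_mat n m"
    and K: "0 \<le> K"
    and A1K: "\<And>u. u \<in> U \<Longrightarrow> max_norm (A1 u) \<le> K"
    and B1K: "\<And>u. u \<in> U \<Longrightarrow> max_norm (B1 u) \<le> K"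
    and dAK: "\<And>\<eta> u. 0 < \<eta> \<Longrightarrow> \<eta> \<le> 1 \<Longrightarrow> u \<in> U \<Longrightarrow> max_norm (\<delta>A \<eta> u - \<eta> \<cdot>\<^sub>m A1 u) \<le> K * \<eta>\<^sup>2"
    and dBK: "\<And>\<eta> u. 0 < \<eta> \<Longrightarrow> \<eta> \<le> 1 \<Longrightarrow> u \<in> U \<Longrightarrow> max_norm (\<delta>B \<eta> u - \<eta> \<cdot>\<^sub>m B1 u) \<le> K * \<eta>\<^sup>2"
  obtains r C where "0 < r"
    "\<forall>\<eta> u. 0 < \<eta> \<longrightarrow> \<eta> \<le> r \<longrightarrow> u \<in> U \<longrightarrow>
      (\<exists>D\<in>carrier_mat n m. (A + \<delta>A \<eta> u) * (X + D) = A * X + \<delta>B \<eta> u)"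
    "\<forall>\<eta> u D. 0 < \<eta> \<longrightarrow> \<eta> \<le> r \<longrightarrow> u \<in> U \<longrightarrow> D \<in> carrier_mat n m \<longrightarrow>
      (A + \<delta>A \<eta> u) * (X + D) = A * X + \<delta>B \<eta> u \<longrightarrow>
      \<bar>max_norm D - \<eta> * max_norm (G * (B1 u - A1 u * X))\<bar> \<le> C * \<eta>\<^sup>2"
proof -
  define g where "g = real n * max_norm G"
  define x where "x = max_norm X"
  define c0 where "c0 = g * (real n * (2 * K))"
  define c1 where "c1 = g * (K + real n * K * x)"
  \<comment> \<open>The radius is chosen such that \<open>\<eta> * c0 \<le> 1 / 2\<close>, which makes \<open>D \<mapsto> G (\<delta>A D)\<close> a contraction.\<close>
  define r where "r = min 1 (1 / (2 * c0 + 1))"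
  have g0: "0 \<le> g" and x0: "0 \<le> x"
    using max_norm_nonneg G X n m by (auto simp: g_def x_def)
  have c0: "0 \<le> c0" and c1: "0 \<le> c1"
    using g0 x0 K by (auto simp: c0_def c1_def)
  have r: "0 < r" using c0 by (simp add: r_def)

  have dA_le: "max_norm (\<delta>A \<eta> u) \<le> 2 * K * \<eta>" if "0 < \<eta>" "\<eta> \<le> 1" "u \<in> U" for \<eta> u
  proof -
    have "max_norm (\<delta>A \<eta> u) \<le> max_norm (\<eta> \<cdot>\<^sub>m A1 u) + max_norm (\<delta>A \<eta> u - \<eta> \<cdot>\<^sub>m A1 u)"
      using dA A1 n by (intro max_norm_le_diff[of _ n n]) auto
    also have "\<dots> \<le> \<eta> * K + K * \<eta>\<^sup>2"
      using that A1K[of u] dAK[of \<eta> u] max_norm_smult[OF A1 n n, of \<eta> u]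
      by (intro add_mono) auto
    also have "K * \<eta>\<^sup>2 \<le> K * \<eta>"
      using that K by (intro mult_left_mono) (auto simp: power2_eq_square mult_le_one)
    finally show ?thesis by (simp add: algebra_simps)
  qed

  have G_mult: "max_norm (G * Y) \<le> g * max_norm Y" if "Y \<in> carrier_mat n k" "0 < k" for Y k
    using max_norm_mult[OF G that(1) n that(2)] by (simp add: g_def)

  have contr: "max_norm (G * (\<delta>A \<eta> u * D)) \<le> c0 * \<eta> * max_norm D"
    if "0 < \<eta>" "\<eta> \<le> 1" "u \<in> U" "D \<in> carrier_mat n k" "0 < k" for \<eta> u D k
  proof -
    have D0: "0 \<le> max_norm D" using max_norm_nonneg that n by blast
    have "max_norm (G * (\<delta>A \<eta> u * D)) \<le> g * max_norm (\<delta>A \<eta> u * D)"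
      using that by (intro G_mult[of _ k] mult_carrier_mat[OF dA]) auto
    also have "\<dots> \<le> g * (real n * (2 * K * \<eta>) * max_norm D)"
    proof (rule mult_left_mono[OF _ g0])
      have "max_norm (\<delta>A \<eta> u * D) \<le> real n * max_norm (\<delta>A \<eta> u) * max_norm D"
        using that n by (intro max_norm_mult[OF dA]) auto
      also have "\<dots> \<le> real n * (2 * K * \<eta>) * max_norm D"
        using dA_le that D0 by (intro mult_right_mono mult_left_mono) auto
      finally show "max_norm (\<delta>A \<eta> u * D) \<le> real n * (2 * K * \<eta>) * max_norm D" .
    qed
    finally show ?thesis by (simp add: c0_def mult_ac)
  qed

  have half: "c0 * \<eta> \<le> 1 / 2" if "0 < \<eta>" "\<eta> \<le> r" for \<eta>
  proof -
    have "c0 * \<eta> \<le> c0 * (1 / (2 * c0 + 1))"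
      using that c0 by (intro mult_left_mono) (auto simp: r_def)
    also have "\<dots> \<le> 1 / 2" using c0 by (simp add: field_simps)
    finally show ?thesis .
  qed

  have contr_half: "max_norm (G * (\<delta>A \<eta> u * D)) \<le> max_norm D / 2"
    if "0 < \<eta>" "\<eta> \<le> r" "u \<in> U" "D \<in> carrier_mat n k" "0 < k" for \<eta> u D k
  proof -
    have "max_norm (G * (\<delta>A \<eta> u * D)) \<le> c0 * \<eta> * max_norm D"
      using that by (intro contr) (auto simp: r_def)
    also have "\<dots> \<le> 1 / 2 * max_norm D"
      using half that max_norm_nonneg[of D n k] n by (intro mult_right_mono) auto
    finally show ?thesis by simp
  qed

  have ex: "\<exists>D\<in>carrier_mat n m. (A + \<delta>A \<eta> u) * (X + D) = A * X + \<delta>B \<eta> u"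
    if "0 < \<eta>" "\<eta> \<le> r" "u \<in> U" for \<eta> u
  proof -
    have small: "max_norm (G * (\<delta>A \<eta> u * V)) \<le> max_norm V / 2"
      if "V \<in> carrier_mat n 1" for V
      using contr_half[OF \<open>0 < \<eta>\<close> \<open>\<eta> \<le> r\<close> \<open>u \<in> U\<close> that] by simp
    obtain J where J: "J \<in> carrier_mat n n" "(A + \<delta>A \<eta> u) * J = 1\<^sub>m n"
      by (rule perturbed_matrix_right_inverse[OF n A dA G GA small])
    define R where "R = A * X + \<delta>B \<eta> u"
    have R: "R \<in> carrier_mat n m" using A X dB by (simp add: R_def)
    have JR: "J * R \<in> carrier_mat n m" using J R by simp
    have "X + (J * R - X) = J * R"
      using X JR carrier_matD[OF JR] by (intro eq_matI) (auto simp del: index_mult_mat)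
    moreover have "(A + \<delta>A \<eta> u) * (J * R) = R"
      using assoc_mult_mat[of "A + \<delta>A \<eta> u" n n J n R m] A dA[of \<eta> u] J R by simp
    ultimately have "(A + \<delta>A \<eta> u) * (X + (J * R - X)) = R" by simp
    then show ?thesis using X by (intro bexI[of _ "J * R - X"]) (auto simp: R_def)
  qed

  have est: "\<bar>max_norm D - \<eta> * max_norm (G * (B1 u - A1 u * X))\<bar> \<le> (4 * c0 * c1 + c1) * \<eta>\<^sup>2"
    if \<eta>: "0 < \<eta>" "\<eta> \<le> r" and u: "u \<in> U" and D: "D \<in> carrier_mat n m"
      and sol: "(A + \<delta>A \<eta> u) * (X + D) = A * X + \<delta>B \<eta> u" for \<eta> u D
  proof -
    have \<eta>1: "\<eta> \<le> 1" using \<eta> by (simp add: r_def)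
    define W where "W = G * (\<delta>B \<eta> u - \<delta>A \<eta> u * X)"
    define W1 where "W1 = G * (B1 u - A1 u * X)"
    define R where "R = G * (\<delta>A \<eta> u * D)"
    define E where "E = \<delta>A \<eta> u - \<eta> \<cdot>\<^sub>m A1 u"
    define F where "F = \<delta>B \<eta> u - \<eta> \<cdot>\<^sub>m B1 u"
    note car = A G X dA[of \<eta> u] dB[of \<eta> u] A1[of u] B1[of u] D
    have W: "W \<in> carrier_mat n m" and W1: "W1 \<in> carrier_mat n m" and R: "R \<in> carrier_mat n m"
      and E: "E \<in> carrier_mat n n" and F: "F \<in> carrier_mat n m"
      using car by (auto simp: W_def W1_def R_def E_def F_def)
    have D_eq: "D = W - R"
      unfolding W_def R_def
      by (rule perturbed_solution_identity[OF A dA G GA X D dB sol])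

    have W1_le: "max_norm W1 \<le> c1"
    proof -
      have "max_norm (B1 u - A1 u * X) \<le> max_norm (B1 u) + max_norm (A1 u * X)"
        using car n m by (intro max_norm_minus[of _ n m]) auto
      also have "max_norm (A1 u * X) \<le> real n * max_norm (A1 u) * x"
        unfolding x_def using car n m by (intro max_norm_mult[of _ n n _ m]) auto
      also have "\<dots> \<le> real n * K * x"
        using A1K u x0 by (intro mult_right_mono mult_left_mono) auto
      finally have "max_norm (B1 u - A1 u * X) \<le> K + real n * K * x"
        using B1K[OF u] by simp
      from mult_left_mono[OF this g0] show ?thesis
        unfolding W1_def c1_def using car m by (intro order_trans[OF G_mult[of _ m]]) auto
    qed

    have W_W1: "max_norm (W - \<eta> \<cdot>\<^sub>m W1) \<le> c1 * \<eta>\<^sup>2"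
    proof -
      have "F - E * X = (\<delta>B \<eta> u - \<delta>A \<eta> u * X) - \<eta> \<cdot>\<^sub>m (B1 u - A1 u * X)"
      proof -
        have cc: "\<delta>A \<eta> u * X \<in> carrier_mat n m" "A1 u * X \<in> carrier_mat n m"
          using car by auto
        have "E * X = \<delta>A \<eta> u * X - \<eta> \<cdot>\<^sub>m (A1 u * X)"
          using car minus_mult_distrib_mat[of "\<delta>A \<eta> u" n n "\<eta> \<cdot>\<^sub>m A1 u" X m]
          by (simp add: E_def mult_smult_assoc_mat[of _ n n _ m])
        then show ?thesis
          using car cc carrier_matD[OF cc(1)] carrier_matD[OF cc(2)]
          by (intro eq_matI) (auto simp: F_def algebra_simps simp del: index_mult_mat)
      qed
      moreover have Z: "\<delta>B \<eta> u - \<delta>A \<eta> u * X \<in> carrier_mat n m" "B1 u - A1 u * X \<in> carrier_mat n m"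
        using car by auto
      ultimately have "W - \<eta> \<cdot>\<^sub>m W1 = G * (F - E * X)"
        unfolding W_def W1_def
        by (simp only: mult_minus_distrib_mat[OF G Z(1) smult_carrier_mat[OF Z(2)]]
            mult_smult_distrib[OF G Z(2)])
      then have le: "max_norm (W - \<eta> \<cdot>\<^sub>m W1) \<le> g * max_norm (F - E * X)"
        using E F X m by (simp, intro G_mult[of _ m]) auto
      have "max_norm (F - E * X) \<le> max_norm F + max_norm (E * X)"
        using E F X n m by (intro max_norm_minus[of _ n m]) auto
      also have "max_norm (E * X) \<le> real n * max_norm E * x"
        unfolding x_def using E X n m by (intro max_norm_mult[of _ n n _ m]) auto
      also have "\<dots> \<le> real n * (K * \<eta>\<^sup>2) * x"
        unfolding E_def using dAK \<eta> \<eta>1 u x0 by (intro mult_right_mono mult_left_mono) auto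
      also have "max_norm F \<le> K * \<eta>\<^sup>2"
        unfolding F_def using dBK \<eta> \<eta>1 u by auto
      finally have "max_norm (F - E * X) \<le> (K + real n * K * x) * \<eta>\<^sup>2"
        by (simp add: algebra_simps)
      from le mult_left_mono[OF this g0] show ?thesis
        by (simp add: c1_def mult.assoc)
    qed

    have W_le: "max_norm W \<le> 2 * c1 * \<eta>"
    proof -
      have "max_norm W \<le> max_norm (\<eta> \<cdot>\<^sub>m W1) + max_norm (W - \<eta> \<cdot>\<^sub>m W1)"
        using W W1 n m by (intro max_norm_le_diff[of _ n m]) auto
      also have "\<dots> \<le> \<eta> * c1 + c1 * \<eta>\<^sup>2"
        using W1_le W_W1 \<eta> max_norm_smult[OF W1 n m \<eta>(1)] by (intro add_mono) auto
      also have "c1 * \<eta>\<^sup>2 \<le> c1 * \<eta>"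
        using \<eta> \<eta>1 c1 by (intro mult_left_mono) (auto simp: power2_eq_square mult_le_one)
      finally show ?thesis by (simp add: algebra_simps)
    qed

    have "max_norm D \<le> max_norm W + max_norm R"
      unfolding D_eq using W R n m by (intro max_norm_minus[of _ n m]) auto
    moreover have "max_norm R \<le> max_norm D / 2"
      unfolding R_def using contr_half \<eta> u D m by blast
    ultimately have D_le: "max_norm D \<le> 4 * c1 * \<eta>" using W_le by linarith

    have "max_norm R \<le> c0 * \<eta> * max_norm D"
      unfolding R_def using contr \<eta> \<eta>1 u D m by blast
    also have "\<dots> \<le> c0 * \<eta> * (4 * c1 * \<eta>)"
      using D_le c0 \<eta> by (intro mult_left_mono) auto
    finally have R_le: "max_norm R \<le> 4 * c0 * c1 * \<eta>\<^sup>2"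
      by (simp add: power2_eq_square mult_ac)

    have "D - \<eta> \<cdot>\<^sub>m W1 = (W - \<eta> \<cdot>\<^sub>m W1) - R"
      unfolding D_eq using W W1 R by (intro eq_matI) auto
    then have "max_norm (D - \<eta> \<cdot>\<^sub>m W1) \<le> max_norm (W - \<eta> \<cdot>\<^sub>m W1) + max_norm R"
      using W W1 R n m by (simp, intro max_norm_minus[of _ n m]) auto
    then have close: "max_norm (D - \<eta> \<cdot>\<^sub>m W1) \<le> (4 * c0 * c1 + c1) * \<eta>\<^sup>2"
      using W_W1 R_le by (simp add: algebra_simps)
    have "max_norm D \<le> \<eta> * max_norm W1 + max_norm (D - \<eta> \<cdot>\<^sub>m W1)"
      using max_norm_le_diff[of D n m "\<eta> \<cdot>\<^sub>m W1"] D W1 n m \<eta> by (simp add: max_norm_smult)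
    moreover have "\<eta> * max_norm W1 \<le> max_norm D + max_norm (D - \<eta> \<cdot>\<^sub>m W1)"
      using max_norm_le_diff[of "\<eta> \<cdot>\<^sub>m W1" n m D] max_norm_diff_commute[of "\<eta> \<cdot>\<^sub>m W1" n m D]
        D W1 n m \<eta> by (simp add: max_norm_smult)
    ultimately show ?thesis using close unfolding W1_def by linarith
  qed
  show ?thesis by (rule that[OF r]) (use ex est in blast)+
qed

text \<open>
  A supremum depends on its family in a non-expansive way, so uniform convergence of the family
  carries over.  The supremum may be infinite or taken over the empty family.
\<close>

lemma Sup_tendsto_SUP:
  fixes S :: "real \<Rightarrow> ereal set" and l :: "'u \<Rightarrow> ereal"
  assumes r: "0 < r"
    and upper: "\<And>\<eta> s. 0 < \<eta> \<Longrightarrow> \<eta> \<le> r \<Longrightarrow> s \<in> S \<eta> \<Longrightarrow> \<exists>u\<in>U. s \<le> l u + ereal (C * \<eta>)"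
    and lower: "\<And>\<eta> u. 0 < \<eta> \<Longrightarrow> \<eta> \<le> r \<Longrightarrow> u \<in> U \<Longrightarrow> \<exists>s\<in>S \<eta>. l u \<le> s + ereal (C * \<eta>)"
  shows "((\<lambda>\<eta>. Sup (S \<eta>)) \<longlongrightarrow> (SUP u\<in>U. l u)) (at_right 0)"
proof (rule tendsto_sandwich)
  let ?c = "SUP u\<in>U. l u"
  have ev: "eventually (\<lambda>\<eta>. 0 < \<eta> \<and> \<eta> \<le> r) (at_right 0)"
    using r unfolding eventually_at_right_field by (auto intro!: exI[of _ r])
  have "Sup (S \<eta>) \<le> ?c + ereal (C * \<eta>)" if \<eta>: "0 < \<eta>" "\<eta> \<le> r" for \<eta>
  proof (rule Sup_least)
    fix s assume "s \<in> S \<eta>"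
    with upper[OF \<eta>] obtain u where "u \<in> U" "s \<le> l u + ereal (C * \<eta>)" by blast
    then show "s \<le> ?c + ereal (C * \<eta>)"
      by (meson SUP_upper add_right_mono order_trans)
  qed
  then show "eventually (\<lambda>\<eta>. Sup (S \<eta>) \<le> ?c + ereal (C * \<eta>)) (at_right 0)"
    using ev by (auto elim: eventually_mono)
  have "?c + ereal (- (C * \<eta>)) \<le> Sup (S \<eta>)" if \<eta>: "0 < \<eta>" "\<eta> \<le> r" for \<eta>
  proof -
    have "?c \<le> Sup (S \<eta>) + ereal (C * \<eta>)"
    proof (rule SUP_least)
      fix u assume "u \<in> U"
      with lower[OF \<eta>] obtain s where "s \<in> S \<eta>" "l u \<le> s + ereal (C * \<eta>)" by blast
      then show "l u \<le> Sup (S \<eta>) + ereal (C * \<eta>)"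
        by (meson Sup_upper add_right_mono order_trans)
    qed
    then show ?thesis by (cases ?c; cases "Sup (S \<eta>)") auto
  qed
  then show "eventually (\<lambda>\<eta>. ?c + ereal (- (C * \<eta>)) \<le> Sup (S \<eta>)) (at_right 0)"
    using ev by (auto elim: eventually_mono)
  have "((\<lambda>\<eta>. ereal (C * \<eta>)) \<longlongrightarrow> ereal (C * 0)) (at_right 0)"
    and "((\<lambda>\<eta>. ereal (- (C * \<eta>))) \<longlongrightarrow> ereal (- (C * 0))) (at_right 0)"
    by (intro tendsto_intros)+
  then show "((\<lambda>\<eta>. ?c + ereal (C * \<eta>)) \<longlongrightarrow> ?c) (at_right 0)"
    and "((\<lambda>\<eta>. ?c + ereal (- (C * \<eta>))) \<longlongrightarrow> ?c) (at_right 0)"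
    using tendsto_add_ereal_general1[of 0 "\<lambda>_. ?c" ?c "at_right 0"] by (auto simp: zero_ereal_def)
qed

text \<open>
  The limit, which is the condition number, is the supremum over the directions \<open>u\<close> of the norms
  of the directional derivatives \<open>G (B1 u - A1 u X)\<close> of the solution, relative to \<open>X\<close>.
\<close>

lemma perturbed_system_limit:
  fixes \<delta>A \<delta>B :: "real \<Rightarrow> 'u \<Rightarrow> real mat" and A1 B1 :: "'u \<Rightarrow> real mat"
  assumes n: "0 < n" and m: "0 < m"
    and A: "A \<in> carrier_mat n n" and G: "G \<in> carrier_mat n n" and GA: "G * A = 1\<^sub>m n"
    and X: "X \<in> carrier_mat n m"
    and dA: "\<And>\<eta> u. \<delta>A \<eta> u \<in> carrier_mat n n" and dB: "\<And>\<eta> u. \<delta>B \<eta> u \<in> carrier_mat n m"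
    and A1: "\<And>u. A1 u \<in> carrier_mat n n" and B1: "\<And>u. B1 u \<in> carrier_mat n m"
    and K: "0 \<le> K"
    and A1K: "\<And>u. u \<in> U \<Longrightarrow> max_norm (A1 u) \<le> K"
    and B1K: "\<And>u. u \<in> U \<Longrightarrow> max_norm (B1 u) \<le> K"
    and dAK: "\<And>\<eta> u. 0 < \<eta> \<Longrightarrow> \<eta> \<le> 1 \<Longrightarrow> u \<in> U \<Longrightarrow> max_norm (\<delta>A \<eta> u - \<eta> \<cdot>\<^sub>m A1 u) \<le> K * \<eta>\<^sup>2"
    and dBK: "\<And>\<eta> u. 0 < \<eta> \<Longrightarrow> \<eta> \<le> 1 \<Longrightarrow> u \<in> U \<Longrightarrow> max_norm (\<delta>B \<eta> u - \<eta> \<cdot>\<^sub>m B1 u) \<le> K * \<eta>\<^sup>2"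
  shows "((\<lambda>\<eta>. Sup {ereal (1 / \<eta> * (max_norm D / max_norm X)) | D u. u \<in> U \<and> D \<in> carrier_mat n m \<and>
            (A + \<delta>A \<eta> u) * (X + D) = A * X + \<delta>B \<eta> u})
          \<longlongrightarrow> (SUP u\<in>U. ereal (max_norm (G * (B1 u - A1 u * X)) / max_norm X))) (at_right 0)"
proof -
  obtain r C where r: "0 < r"
    and ex: "\<forall>\<eta> u. 0 < \<eta> \<longrightarrow> \<eta> \<le> r \<longrightarrow> u \<in> U \<longrightarrow>
      (\<exists>D\<in>carrier_mat n m. (A + \<delta>A \<eta> u) * (X + D) = A * X + \<delta>B \<eta> u)"
    and est: "\<forall>\<eta> u D. 0 < \<eta> \<longrightarrow> \<eta> \<le> r \<longrightarrow> u \<in> U \<longrightarrow> D \<in> carrier_mat n m \<longrightarrow>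
      (A + \<delta>A \<eta> u) * (X + D) = A * X + \<delta>B \<eta> u \<longrightarrow>
      \<bar>max_norm D - \<eta> * max_norm (G * (B1 u - A1 u * X))\<bar> \<le> C * \<eta>\<^sup>2"
    by (rule perturbed_system_first_order[where \<delta>A = \<delta>A and \<delta>B = \<delta>B and ?A1.0 = A1
          and ?B1.0 = B1 and U = U, OF assms])
  have x0: "0 \<le> max_norm X" using X n m by (rule max_norm_nonneg)
  have bounds: "1 / \<eta> * (max_norm D / max_norm X)
        \<le> max_norm (G * (B1 u - A1 u * X)) / max_norm X + C / max_norm X * \<eta>"
      "max_norm (G * (B1 u - A1 u * X)) / max_norm X
        \<le> 1 / \<eta> * (max_norm D / max_norm X) + C / max_norm X * \<eta>"
    if \<eta>: "0 < \<eta>" "\<eta> \<le> r" and u: "u \<in> U" and D: "D \<in> carrier_mat n m"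
      and sol: "(A + \<delta>A \<eta> u) * (X + D) = A * X + \<delta>B \<eta> u" for \<eta> u D
  proof -
    let ?L = "max_norm (G * (B1 u - A1 u * X))"
    have e: "\<bar>max_norm D - \<eta> * ?L\<bar> \<le> C * \<eta>\<^sup>2" using est \<eta> u D sol by blast
    have "max_norm D / \<eta> \<le> ?L + C * \<eta>" "?L \<le> max_norm D / \<eta> + C * \<eta>"
      using e \<eta>(1) by (auto simp: field_simps power2_eq_square)
    from this[THEN divide_right_mono, OF x0]
    show "1 / \<eta> * (max_norm D / max_norm X) \<le> ?L / max_norm X + C / max_norm X * \<eta>"
      "?L / max_norm X \<le> 1 / \<eta> * (max_norm D / max_norm X) + C / max_norm X * \<eta>"
      by (simp_all add: add_divide_distrib mult.commute)
  qed
  show ?thesis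
  proof (rule Sup_tendsto_SUP[OF r, where C = "C / max_norm X"], goal_cases)
    case (1 \<eta> s)
    then show ?case using bounds(1)[OF 1(1,2)] by fastforce
  next
    case (2 \<eta> u)
    then obtain D where "D \<in> carrier_mat n m" "(A + \<delta>A \<eta> u) * (X + D) = A * X + \<delta>B \<eta> u"
      using ex by blast
    then show ?case using bounds(2)[OF 2, of D] 2 by force
  qed
qed

section \<open>Products of perturbed factors\<close>

text \<open>
  The two bounds are proved in one induction because the step of the second-order bound uses the
  first-order one: \<open>(1 + t) p - 1 - (t + s) = (p - 1 - s) + t (p - 1)\<close>.  The constant
  \<open>2 ^ card P\<close> is crude; it only has to be independent of \<open>t\<close> and \<open>\<eta>\<close>.
\<close>

lemma prod_one_plus_expansion:
  fixes t :: "'i \<Rightarrow> real"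
  assumes "finite P" "\<And>x. x \<in> P \<Longrightarrow> \<bar>t x\<bar> \<le> \<eta>" "0 \<le> \<eta>"
  shows prod_one_plus_minus_one: "\<bar>(\<Prod>x\<in>P. 1 + t x) - 1\<bar> \<le> (1 + \<eta>) ^ card P - 1"
    and prod_one_plus_second_order:
      "\<eta> \<le> 1 \<Longrightarrow> \<bar>(\<Prod>x\<in>P. 1 + t x) - 1 - (\<Sum>x\<in>P. t x)\<bar> \<le> 2 ^ card P * \<eta>\<^sup>2"
proof -
  have "\<bar>(\<Prod>x\<in>P. 1 + t x) - 1\<bar> \<le> (1 + \<eta>) ^ card P - 1 \<and>
    (\<eta> \<le> 1 \<longrightarrow> \<bar>(\<Prod>x\<in>P. 1 + t x) - 1 - (\<Sum>x\<in>P. t x)\<bar> \<le> 2 ^ card P * \<eta>\<^sup>2)"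
    using assms(1,2)
  proof (induction P rule: finite_induct)
    case empty
    then show ?case using assms(3) by simp
  next
    case (insert y P)
    let ?p = "\<Prod>x\<in>P. 1 + t x" and ?s = "\<Sum>x\<in>P. t x" and ?k = "card P"
    have IH1: "\<bar>?p - 1\<bar> \<le> (1 + \<eta>) ^ ?k - 1"
      and IH2: "\<eta> \<le> 1 \<Longrightarrow> \<bar>?p - 1 - ?s\<bar> \<le> 2 ^ ?k * \<eta>\<^sup>2"
      using insert by auto
    have ty: "\<bar>t y\<bar> \<le> \<eta>" using insert by simp
    have "(1 + t y) * ?p - 1 = (?p - 1) + t y * ?p" by (simp add: algebra_simps)
    also have "\<bar>\<dots>\<bar> \<le> \<bar>?p - 1\<bar> + \<bar>t y\<bar> * \<bar>?p\<bar>"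
      by (metis abs_mult abs_triangle_ineq)
    also have "\<dots> \<le> ((1 + \<eta>) ^ ?k - 1) + \<eta> * (1 + \<eta>) ^ ?k"
      using IH1 ty assms(3) by (intro add_mono mult_mono) auto
    finally have one: "\<bar>(1 + t y) * ?p - 1\<bar> \<le> (1 + \<eta>) ^ Suc ?k - 1"
      by (simp add: algebra_simps)
    have two: "\<bar>(1 + t y) * ?p - 1 - (t y + ?s)\<bar> \<le> 2 ^ Suc ?k * \<eta>\<^sup>2" if "\<eta> \<le> 1"
    proof -
      have pow: "(1 + \<eta>) ^ k - 1 \<le> 2 ^ k * \<eta>" for k
      proof (induction k)
        case (Suc k)
        have "(1 + \<eta>) ^ Suc k - 1 = ((1 + \<eta>) ^ k - 1) + (1 + \<eta>) ^ k * \<eta>"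
          by (simp add: algebra_simps)
        also have "\<dots> \<le> 2 ^ k * \<eta> + 2 ^ k * \<eta>"
          using Suc that assms(3) by (intro add_mono mult_right_mono power_mono) auto
        finally show ?case by (simp add: mult_ac)
      qed (use assms(3) in simp)
      have "(1 + t y) * ?p - 1 - (t y + ?s) = (?p - 1 - ?s) + t y * (?p - 1)"
        by (simp add: algebra_simps)
      also have "\<bar>\<dots>\<bar> \<le> \<bar>?p - 1 - ?s\<bar> + \<bar>t y\<bar> * \<bar>?p - 1\<bar>"
        by (metis abs_mult abs_triangle_ineq)
      also have "\<dots> \<le> 2 ^ ?k * \<eta>\<^sup>2 + \<eta> * (2 ^ ?k * \<eta>)"
        using IH1 IH2[OF that] ty assms(3) pow[of ?k] by (intro add_mono mult_mono) auto
      finally show ?thesis by (simp add: power2_eq_square algebra_simps)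
    qed
    show ?case using one two insert by simp
  qed
  then show "\<bar>(\<Prod>x\<in>P. 1 + t x) - 1\<bar> \<le> (1 + \<eta>) ^ card P - 1"
    and "\<eta> \<le> 1 \<Longrightarrow> \<bar>(\<Prod>x\<in>P. 1 + t x) - 1 - (\<Sum>x\<in>P. t x)\<bar> \<le> 2 ^ card P * \<eta>\<^sup>2"
    by auto
qed

text \<open>
  A parameter that vanishes is not perturbed at all, so the convention \<open>e / 0 = 0\<close> gives its
  relative perturbation correctly.
\<close>

lemma prod_rel_perturbed:
  fixes w e :: "'i \<Rightarrow> real"
  assumes "rel_bounded I \<eta> e w" "P \<subseteq> I"
  shows "(\<Prod>x\<in>P. w x + e x) = (\<Prod>x\<in>P. w x) * (\<Prod>x\<in>P. 1 + e x / w x)"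
  unfolding prod.distrib[symmetric]
proof (rule prod.cong)
  fix x assume "x \<in> P"
  then have "\<bar>e x\<bar> \<le> \<eta> * \<bar>w x\<bar>" using assms by (auto simp: rel_bounded_def)
  then show "w x + e x = w x * (1 + e x / w x)"
    by (cases "w x = 0") (auto simp: field_simps)
qed simp

lemma rel_bounded_quotient:
  assumes "rel_bounded I \<eta> e w" "x \<in> I" "0 \<le> \<eta>"
  shows "\<bar>e x / w x\<bar> \<le> \<eta>"
  using assms by (cases "w x = 0") (auto simp: rel_bounded_def field_simps)

lemma rel_bounded_scale:
  assumes "0 < \<eta>"
  shows "rel_bounded I \<eta> (\<lambda>x. \<eta> * e x) w \<longleftrightarrow> rel_bounded I 1 e w"
  using assms by (simp add: rel_bounded_def abs_mult)

lemma mat_rel_bounded_scale: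
  assumes "0 < \<eta>" "A \<in> carrier_mat n m" "H \<in> carrier_mat n m"
  shows "mat_rel_bounded \<eta> (\<eta> \<cdot>\<^sub>m H) A \<longleftrightarrow> mat_rel_bounded 1 H A"
proof -
  have "(\<eta> \<cdot>\<^sub>m H) $$ (i, j) = \<eta> * H $$ (i, j)" if "i < n" "j < m" for i j
    using that assms(3) by auto
  then show ?thesis
    unfolding mat_rel_bounded_def carrier_matD[OF assms(2)] using assms(1)
    by (auto simp: abs_mult)
qed

text \<open>
  Rescaling replaces the admissible set, which shrinks with \<open>\<eta>\<close>, by a fixed set of directions,
  over which uniform convergence can be stated.
\<close>

lemma ex_rel_bounded_scale:
  assumes "0 < \<eta>"
  shows "(\<exists>\<delta>. rel_bounded I \<eta> \<delta> w \<and> Q \<delta>) \<longleftrightarrow> (\<exists>e. rel_bounded I 1 e w \<and> Q (\<lambda>x. \<eta> * e x))"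
proof
  assume "\<exists>\<delta>. rel_bounded I \<eta> \<delta> w \<and> Q \<delta>"
  then obtain \<delta> where "rel_bounded I \<eta> \<delta> w" "Q \<delta>" by blast
  then show "\<exists>e. rel_bounded I 1 e w \<and> Q (\<lambda>x. \<eta> * e x)"
    using rel_bounded_scale[OF assms, of I "\<lambda>x. \<delta> x / \<eta>" w] assms
    by (intro exI[of _ "\<lambda>x. \<delta> x / \<eta>"]) simp
qed (use rel_bounded_scale[OF assms] in blast)

section \<open>Quasiseparable and sparse matrices\<close>

definition qs_factors :: "nat \<Rightarrow> nat \<Rightarrow> qs_index set" where
  "qs_factors i j =
     (if i = j then {QS_d i}
      else if i > j then {QS_p i, QS_q j} \<union> QS_a ` {j<..<i}
      else {QS_g i, QS_h j} \<union> QS_b ` {i<..<j})"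

lemma qs_entry_eq_prod: "qs_entry \<Omega> i j = (\<Prod>x\<in>qs_factors i j. \<Omega> x)"
proof -
  have "(\<Prod>x\<in>QS_a ` {j<..<i}. \<Omega> x) = (\<Prod>k\<in>{j<..<i}. \<Omega> (QS_a k))"
    "(\<Prod>x\<in>QS_b ` {i<..<j}. \<Omega> x) = (\<Prod>k\<in>{i<..<j}. \<Omega> (QS_b k))"
    by (simp_all add: prod.reindex inj_on_def)
  moreover have "QS_p i \<notin> insert (QS_q j) (QS_a ` {j<..<i})" "QS_q j \<notin> QS_a ` {j<..<i}"
    "QS_g i \<notin> insert (QS_h j) (QS_b ` {i<..<j})" "QS_h j \<notin> QS_b ` {i<..<j}"
    by auto
  ultimately show ?thesis
    unfolding qs_entry_def qs_factors_def by (simp add: mult_ac)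
qed

lemma finite_qs_factors: "finite (qs_factors i j)"
  by (simp add: qs_factors_def)

lemma qs_factors_subset:
  assumes "i \<in> {1..n}" "j \<in> {1..n}"
  shows "qs_factors i j \<subseteq> qs_indices n"
  using assms by (auto simp: qs_factors_def qs_indices_def)

text \<open>
  An entry off the diagonal has two outer generators and one inner generator for each index
  strictly between \<open>i\<close> and \<open>j\<close>, hence \<open>\<bar>i - j\<bar> + 1\<close> factors; the extreme case is a corner.
\<close>

lemma card_qs_factors_le:
  assumes "i \<in> {1..n}" "j \<in> {1..n}"
  shows "card (qs_factors i j) \<le> n"
proof -
  have "card (insert x (insert y (f ` {k<..<l}))) \<le> n" if "k < l" "l \<le> n" "1 \<le> k"
    for x y :: qs_index and f and k l
  proof -
    have "card (insert x (insert y (f ` {k<..<l}))) \<le> Suc (Suc (card (f ` {k<..<l})))"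
      by (auto simp: card_insert_if)
    also have "card (f ` {k<..<l}) \<le> l - Suc k"
      using card_image_le[of "{k<..<l}" f] by simp
    finally show ?thesis using that by linarith
  qed
  then show ?thesis using assms by (auto simp: qs_factors_def)
qed

lemma qs_mat_carrier: "qs_mat n \<Omega> \<in> carrier_mat n n"
  by (simp add: qs_mat_def)

lemma qs_mat_entry_perturbed:
  assumes "rel_bounded (qs_indices n) \<eta> \<delta>\<Omega> \<Omega>" "i < n" "j < n"
  shows "qs_mat n (\<lambda>x. \<Omega> x + \<delta>\<Omega> x) $$ (i, j) =
    qs_mat n \<Omega> $$ (i, j) * (\<Prod>x\<in>qs_factors (Suc i) (Suc j). 1 + \<delta>\<Omega> x / \<Omega> x)"
  using assms prod_rel_perturbed[OF assms(1) qs_factors_subset[of "Suc i" n "Suc j"]]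
  by (simp add: qs_mat_def qs_entry_eq_prod)

text \<open>
  This is where the factor \<open>n\<close> comes from: an entry has at most \<open>n\<close> factors, and perturbing them
  multiplies the entry by a product of at most \<open>n\<close> numbers in \<open>[1 - \<eta>, 1 + \<eta>]\<close>.
\<close>

lemma qs_mat_rel_perturbation:
  assumes "rel_bounded (qs_indices n) \<eta> \<delta>\<Omega> \<Omega>" "0 \<le> \<eta>"
  shows "mat_rel_bounded ((1 + \<eta>) ^ n - 1) (qs_mat n (\<lambda>x. \<Omega> x + \<delta>\<Omega> x) - qs_mat n \<Omega>) (qs_mat n \<Omega>)"
  unfolding mat_rel_bounded_def
proof (intro allI impI)
  fix i j assume "i < dim_row (qs_mat n \<Omega>)" "j < dim_col (qs_mat n \<Omega>)"
  then have ij: "i < n" "j < n" by (simp_all add: qs_mat_def)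
  let ?P = "qs_factors (Suc i) (Suc j)"
  let ?pr = "\<Prod>x\<in>?P. 1 + \<delta>\<Omega> x / \<Omega> x"
  have "\<bar>?pr - 1\<bar> \<le> (1 + \<eta>) ^ card ?P - 1"
    using assms ij qs_factors_subset[of "Suc i" n "Suc j"]
    by (intro prod_one_plus_minus_one finite_qs_factors rel_bounded_quotient[OF assms(1)]) auto
  also have "\<dots> \<le> (1 + \<eta>) ^ n - 1"
    using assms(2) ij card_qs_factors_le[of "Suc i" n "Suc j"]
    by (simp add: power_increasing)
  finally have "\<bar>?pr - 1\<bar> \<le> (1 + \<eta>) ^ n - 1" .
  moreover have "(qs_mat n (\<lambda>x. \<Omega> x + \<delta>\<Omega> x) - qs_mat n \<Omega>) $$ (i, j) =
      qs_mat n \<Omega> $$ (i, j) * (?pr - 1)"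
    using qs_mat_entry_perturbed[OF assms(1) ij] ij qs_mat_carrier[of n]
    by (simp add: algebra_simps carrier_matD[OF qs_mat_carrier])
  ultimately show "\<bar>(qs_mat n (\<lambda>x. \<Omega> x + \<delta>\<Omega> x) - qs_mat n \<Omega>) $$ (i, j)\<bar>
      \<le> ((1 + \<eta>) ^ n - 1) * \<bar>qs_mat n \<Omega> $$ (i, j)\<bar>"
    by (simp add: abs_mult mult.commute[of "\<bar>qs_mat n \<Omega> $$ (i, j)\<bar>"] mult_right_mono)
qed

text \<open>
  The derivative of \<open>qs_mat n\<close> at \<open>\<Omega>\<close> in the direction \<open>e\<close>, for directions that vanish where
  \<open>\<Omega>\<close> does: the logarithmic derivative of a product is the sum of those of its factors.
\<close>

definition qs_mat_deriv :: "nat \<Rightarrow> (qs_index \<Rightarrow> real) \<Rightarrow> (qs_index \<Rightarrow> real) \<Rightarrow> real mat" where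
  "qs_mat_deriv n \<Omega> e = mat n n (\<lambda>(i, j).
     qs_mat n \<Omega> $$ (i, j) * (\<Sum>x\<in>qs_factors (Suc i) (Suc j). e x / \<Omega> x))"

lemma qs_mat_deriv_carrier: "qs_mat_deriv n \<Omega> e \<in> carrier_mat n n"
  by (simp add: qs_mat_deriv_def)

lemma max_norm_qs_mat_deriv_le:
  assumes "0 < n" "rel_bounded (qs_indices n) 1 e \<Omega>"
  shows "max_norm (qs_mat_deriv n \<Omega> e) \<le> max_norm (qs_mat n \<Omega>) * 2 ^ n"
  unfolding max_norm_le_iff[OF qs_mat_deriv_carrier assms(1) assms(1)]
proof (intro allI impI)
  fix i j assume ij: "i < n" "j < n"
  let ?P = "qs_factors (Suc i) (Suc j)"
  have "\<bar>\<Sum>x\<in>?P. e x / \<Omega> x\<bar> \<le> (\<Sum>x\<in>?P. \<bar>e x / \<Omega> x\<bar>)" by (rule sum_abs)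
  also have "\<dots> \<le> of_nat (card ?P) * 1"
    using ij qs_factors_subset[of "Suc i" n "Suc j"]
    by (intro sum_bounded_above rel_bounded_quotient[OF assms(2)]) auto
  also have "\<dots> \<le> real n" using card_qs_factors_le[of "Suc i" n "Suc j"] ij by simp
  also have "\<dots> \<le> 2 ^ n" by (simp add: less_imp_le of_nat_less_two_power)
  finally show "\<bar>qs_mat_deriv n \<Omega> e $$ (i, j)\<bar> \<le> max_norm (qs_mat n \<Omega>) * 2 ^ n"
    using ij entry_le_max_norm[OF qs_mat_carrier ij, of \<Omega>]
    by (simp add: qs_mat_deriv_def abs_mult mult_mono)
qed

lemma qs_mat_second_order:
  assumes "0 < n" "rel_bounded (qs_indices n) 1 e \<Omega>" "0 < \<eta>" "\<eta> \<le> 1"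
  shows "max_norm (qs_mat n (\<lambda>x. \<Omega> x + \<eta> * e x) - qs_mat n \<Omega> - \<eta> \<cdot>\<^sub>m qs_mat_deriv n \<Omega> e)
    \<le> max_norm (qs_mat n \<Omega>) * 2 ^ n * \<eta>\<^sup>2" (is "max_norm ?Z \<le> _")
proof -
  have rb: "rel_bounded (qs_indices n) \<eta> (\<lambda>x. \<eta> * e x) \<Omega>"
    using rel_bounded_scale assms by blast
  have "\<bar>?Z $$ (i, j)\<bar> \<le> max_norm (qs_mat n \<Omega>) * 2 ^ n * \<eta>\<^sup>2" if ij: "i < n" "j < n" for i j
  proof -
    let ?P = "qs_factors (Suc i) (Suc j)"
    let ?t = "\<lambda>x. \<eta> * e x / \<Omega> x"
    have "\<bar>(\<Prod>x\<in>?P. 1 + ?t x) - 1 - (\<Sum>x\<in>?P. ?t x)\<bar> \<le> 2 ^ card ?P * \<eta>\<^sup>2"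
      using assms ij qs_factors_subset[of "Suc i" n "Suc j"]
      by (intro prod_one_plus_second_order finite_qs_factors rel_bounded_quotient[OF rb]) auto
    also have "\<dots> \<le> 2 ^ n * \<eta>\<^sup>2"
      using ij card_qs_factors_le[of "Suc i" n "Suc j"]
      by (intro mult_right_mono power_increasing) auto
    finally have *: "\<bar>(\<Prod>x\<in>?P. 1 + ?t x) - 1 - (\<Sum>x\<in>?P. ?t x)\<bar> \<le> 2 ^ n * \<eta>\<^sup>2" .
    have "?Z $$ (i, j) = qs_mat n \<Omega> $$ (i, j) * ((\<Prod>x\<in>?P. 1 + ?t x) - 1 - (\<Sum>x\<in>?P. ?t x))"
      using qs_mat_entry_perturbed[OF rb ij] ij
      by (simp add: qs_mat_deriv_def carrier_matD[OF qs_mat_carrier] algebra_simps sum_distrib_left)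
    then show ?thesis
      using * entry_le_max_norm[OF qs_mat_carrier ij, of \<Omega>]
      by (simp add: abs_mult mult.assoc mult_mono)
  qed
  moreover have "?Z \<in> carrier_mat n n"
    by (intro minus_carrier_mat smult_carrier_mat qs_mat_deriv_carrier)
  ultimately show ?thesis using assms(1) by (intro max_norm_leI[of _ n n])
qed

lemma sparse_mat_carrier: "sparse_mat n m M S \<omega> \<in> carrier_mat n m"
  by (simp add: sparse_mat_def)

lemma sparse_mat_add:
  "sparse_mat n m M S (\<lambda>k. \<omega> k + h k) = sparse_mat n m M S \<omega> + sparse_mat n m M S h"
  by (rule eq_matI) (auto simp: sparse_mat_def algebra_simps sum.distrib)

lemma sparse_mat_smult: "sparse_mat n m M S (\<lambda>k. c * h k) = c \<cdot>\<^sub>m sparse_mat n m M S h"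
  by (rule eq_matI) (auto simp: sparse_mat_def algebra_simps sum_distrib_left)

lemma max_norm_sparse_mat_bounded:
  assumes "0 < n" "0 < m"
  obtains K where "0 \<le> K"
    "\<And>h. rel_bounded {1..M} 1 h \<omega> \<Longrightarrow> max_norm (sparse_mat n m M S h) \<le> K"
proof -
  define T where "T = mat n m (\<lambda>(i, j). \<Sum>k=1..M. \<bar>\<omega> k\<bar> * \<bar>S k $$ (i, j)\<bar>)"
  have T: "T \<in> carrier_mat n m" by (simp add: T_def)
  have "\<bar>sparse_mat n m M S h $$ (i, j)\<bar> \<le> max_norm T"
    if h: "rel_bounded {1..M} 1 h \<omega>" and ij: "i < n" "j < m" for h i j
  proof -
    have "\<bar>\<Sum>k=1..M. h k * S k $$ (i, j)\<bar> \<le> (\<Sum>k=1..M. \<bar>h k * S k $$ (i, j)\<bar>)"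
      by (rule sum_abs)
    also have "\<dots> \<le> (\<Sum>k=1..M. \<bar>\<omega> k\<bar> * \<bar>S k $$ (i, j)\<bar>)"
      using h by (intro sum_mono) (auto simp: rel_bounded_def abs_mult intro!: mult_right_mono)
    also have "\<dots> = T $$ (i, j)" using ij by (simp add: T_def)
    also have "\<dots> \<le> max_norm T" using entry_le_max_norm[OF T ij] by linarith
    finally show ?thesis using ij by (simp add: sparse_mat_def)
  qed
  then have "max_norm (sparse_mat n m M S h) \<le> max_norm T" if "rel_bounded {1..M} 1 h \<omega>" for h
    using that by (intro max_norm_leI[OF sparse_mat_carrier assms])
  then show ?thesis using that max_norm_nonneg[OF T assms] by blast
qed

section \<open>Existence and comparison of the two limits\<close>

definition qs_quotients ::
  "nat \<Rightarrow> nat \<Rightarrow> nat \<Rightarrow> (nat \<Rightarrow> real mat) \<Rightarrow> (qs_index \<Rightarrow> real) \<Rightarrow> (nat \<Rightarrow> real) \<Rightarrow> real mat \<Rightarrow>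
    real \<Rightarrow> ereal set" where
  "qs_quotients n m M S \<Omega> \<omega> X \<eta> =
     {ereal (1 / \<eta> * (max_norm \<delta>X / max_norm X)) | \<delta>X \<delta>\<Omega> \<delta>\<omega>.
        \<delta>X \<in> carrier_mat n m \<and>
        qs_mat n (\<lambda>x. \<Omega> x + \<delta>\<Omega> x) * (X + \<delta>X) = sparse_mat n m M S (\<lambda>k. \<omega> k + \<delta>\<omega> k) \<and>
        rel_bounded (qs_indices n) \<eta> \<delta>\<Omega> \<Omega> \<and>
        rel_bounded {1..M} \<eta> \<delta>\<omega> \<omega>}"

definition entrywise_quotients ::
  "nat \<Rightarrow> nat \<Rightarrow> nat \<Rightarrow> (nat \<Rightarrow> real mat) \<Rightarrow> real mat \<Rightarrow> (nat \<Rightarrow> real) \<Rightarrow> real mat \<Rightarrow>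
    real \<Rightarrow> ereal set" where
  "entrywise_quotients n m M S A \<omega> X \<eta> =
     {ereal (1 / \<eta> * (max_norm \<delta>X / max_norm X)) | \<delta>X \<delta>A \<delta>\<omega>.
        \<delta>X \<in> carrier_mat n m \<and> \<delta>A \<in> carrier_mat n n \<and>
        (A + \<delta>A) * (X + \<delta>X) = sparse_mat n m M S (\<lambda>k. \<omega> k + \<delta>\<omega> k) \<and>
        mat_rel_bounded \<eta> \<delta>A A \<and>
        rel_bounded {1..M} \<eta> \<delta>\<omega> \<omega>}"

lemma cond_qs_eq_Lim:
  "cond_qs n m M S \<Omega> \<omega> X = Lim (at_right 0) (\<lambda>\<eta>. Sup (qs_quotients n m M S \<Omega> \<omega> X \<eta>))"
  by (simp add: cond_qs_def qs_quotients_def)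

lemma cond_entrywise_eq_Lim:
  "cond_entrywise n m M S A \<omega> X = Lim (at_right 0) (\<lambda>\<eta>. Sup (entrywise_quotients n m M S A \<omega> X \<eta>))"
  by (simp add: cond_entrywise_def entrywise_quotients_def)

lemma tendsto_cond_qs:
  assumes n: "0 < n" and m: "0 < m" and X: "X \<in> carrier_mat n m"
    and G: "G \<in> carrier_mat n n" "G * qs_mat n \<Omega> = 1\<^sub>m n"
    and sol: "qs_mat n \<Omega> * X = sparse_mat n m M S \<omega>"
  shows "((\<lambda>\<eta>. Sup (qs_quotients n m M S \<Omega> \<omega> X \<eta>)) \<longlongrightarrow> cond_qs n m M S \<Omega> \<omega> X) (at_right 0)"
proof -
  let ?A = "qs_mat n \<Omega>" and ?I = "qs_indices n"
  define U where "U = {(e, h). rel_bounded ?I 1 e \<Omega> \<and> rel_bounded {1..M} 1 h \<omega>}"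
  define \<delta>A where "\<delta>A = (\<lambda>\<eta> (e, h :: nat \<Rightarrow> real). qs_mat n (\<lambda>x. \<Omega> x + \<eta> * e x) - ?A)"
  define A1 where "A1 = (\<lambda>(e, h :: nat \<Rightarrow> real). qs_mat_deriv n \<Omega> e)"
  define B1 where "B1 = (\<lambda>(e :: qs_index \<Rightarrow> real, h). sparse_mat n m M S h)"
  define \<delta>B where "\<delta>B = (\<lambda>\<eta> u. \<eta> \<cdot>\<^sub>m B1 u)"
  obtain KB where KB: "0 \<le> KB"
      "\<And>h. rel_bounded {1..M} 1 h \<omega> \<Longrightarrow> max_norm (sparse_mat n m M S h) \<le> KB"
    using max_norm_sparse_mat_bounded[OF n m] by blast
  define KA where "KA = max_norm ?A * 2 ^ n"
  have KA: "0 \<le> KA" using max_norm_nonneg[OF qs_mat_carrier n n] by (simp add: KA_def)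
  define L where "L = (SUP u\<in>U. ereal (max_norm (G * (B1 u - A1 u * X)) / max_norm X))"
  have "((\<lambda>\<eta>. Sup {ereal (1 / \<eta> * (max_norm D / max_norm X)) | D u. u \<in> U \<and>
      D \<in> carrier_mat n m \<and> (?A + \<delta>A \<eta> u) * (X + D) = ?A * X + \<delta>B \<eta> u}) \<longlongrightarrow> L) (at_right 0)"
    unfolding L_def
  proof (rule perturbed_system_limit[OF n m qs_mat_carrier G X, where K = "KA + KB"], goal_cases)
    case (6 u)
    then have "max_norm (A1 u) \<le> KA"
      using max_norm_qs_mat_deriv_le[OF n] by (auto simp: U_def A1_def KA_def)
    then show ?case using KB by simp
  next
    case (7 u)
    then have "max_norm (B1 u) \<le> KB" using KB by (auto simp: U_def B1_def)
    then show ?case using KA by simp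
  next
    case (8 \<eta> u)
    then have "max_norm (\<delta>A \<eta> u - \<eta> \<cdot>\<^sub>m A1 u) \<le> KA * \<eta>\<^sup>2"
      using qs_mat_second_order[OF n] by (auto simp: U_def A1_def \<delta>A_def KA_def)
    also have "\<dots> \<le> (KA + KB) * \<eta>\<^sup>2" using KB by (simp add: mult_right_mono)
    finally show ?case .
  next
    case (9 \<eta> u)
    have "B1 u \<in> carrier_mat n m" by (auto simp: B1_def sparse_mat_carrier split: prod.split)
    then have "max_norm (\<delta>B \<eta> u - \<eta> \<cdot>\<^sub>m B1 u) \<le> 0"
      using n m by (subst max_norm_le_iff[of _ n m]) (auto simp: \<delta>B_def)
    moreover have "0 \<le> (KA + KB) * \<eta>\<^sup>2" using KA KB by simp
    ultimately show ?case by linarith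
  qed (use KA KB in \<open>auto simp: \<delta>A_def A1_def B1_def \<delta>B_def sparse_mat_carrier qs_mat_carrier
        qs_mat_deriv_carrier intro!: minus_carrier_mat split: prod.split\<close>)
  moreover have "eventually (\<lambda>\<eta>. Sup {ereal (1 / \<eta> * (max_norm D / max_norm X)) | D u. u \<in> U \<and>
      D \<in> carrier_mat n m \<and> (?A + \<delta>A \<eta> u) * (X + D) = ?A * X + \<delta>B \<eta> u} =
      Sup (qs_quotients n m M S \<Omega> \<omega> X \<eta>)) (at_right 0)"
    using eventually_at_right_less
  proof (rule eventually_mono, goal_cases)
    case (1 \<eta>)
    have "?A + (qs_mat n \<Omega>' - ?A) = qs_mat n \<Omega>'" for \<Omega>'
      by (rule eq_matI) (auto simp: qs_mat_def)
    then have A_eq: "?A + \<delta>A \<eta> (e, h) = qs_mat n (\<lambda>x. \<Omega> x + \<eta> * e x)" for e h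
      by (simp add: \<delta>A_def)
    have B_eq: "?A * X + \<delta>B \<eta> (e, h) = sparse_mat n m M S (\<lambda>k. \<omega> k + \<eta> * h k)" for e h
      by (simp add: \<delta>B_def B1_def sol sparse_mat_add sparse_mat_smult)
    have "{ereal (1 / \<eta> * (max_norm D / max_norm X)) | D u. u \<in> U \<and>
        D \<in> carrier_mat n m \<and> (?A + \<delta>A \<eta> u) * (X + D) = ?A * X + \<delta>B \<eta> u} =
      {s. \<exists>e. rel_bounded ?I 1 e \<Omega> \<and> (\<exists>h. rel_bounded {1..M} 1 h \<omega> \<and> (\<exists>D\<in>carrier_mat n m.
        qs_mat n (\<lambda>x. \<Omega> x + \<eta> * e x) * (X + D) = sparse_mat n m M S (\<lambda>k. \<omega> k + \<eta> * h k) \<and>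
        s = ereal (1 / \<eta> * (max_norm D / max_norm X))))}"
      by (rule Collect_cong, simp only: split_paired_Ex U_def mem_Collect_eq prod.case A_eq B_eq)
        blast
    also have "\<dots> =
      {s. \<exists>e. rel_bounded ?I \<eta> e \<Omega> \<and> (\<exists>h. rel_bounded {1..M} \<eta> h \<omega> \<and> (\<exists>D\<in>carrier_mat n m.
        qs_mat n (\<lambda>x. \<Omega> x + e x) * (X + D) = sparse_mat n m M S (\<lambda>k. \<omega> k + h k) \<and>
        s = ereal (1 / \<eta> * (max_norm D / max_norm X))))}"
      unfolding ex_rel_bounded_scale[OF 1] ..
    also have "\<dots> = qs_quotients n m M S \<Omega> \<omega> X \<eta>"
      unfolding qs_quotients_def by blast
    finally show ?case by simp
  qed
  ultimately have "((\<lambda>\<eta>. Sup (qs_quotients n m M S \<Omega> \<omega> X \<eta>)) \<longlongrightarrow> L) (at_right 0)"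
    by (rule Lim_transform_eventually)
  then show ?thesis
    unfolding cond_qs_eq_Lim by (simp add: tendsto_Lim)
qed

lemma tendsto_cond_entrywise:
  assumes n: "0 < n" and m: "0 < m" and A: "A \<in> carrier_mat n n" and X: "X \<in> carrier_mat n m"
    and G: "G \<in> carrier_mat n n" "G * A = 1\<^sub>m n"
    and sol: "A * X = sparse_mat n m M S \<omega>"
  shows "((\<lambda>\<eta>. Sup (entrywise_quotients n m M S A \<omega> X \<eta>)) \<longlongrightarrow> cond_entrywise n m M S A \<omega> X)
    (at_right 0)"
proof -
  define U where "U = {(H, h). H \<in> carrier_mat n n \<and> mat_rel_bounded 1 H A \<and>
    rel_bounded {1..M} 1 h \<omega>}"
  \<comment> \<open>The restriction to \<open>n\<close> rows and columns only makes the carrier condition hold outside \<open>U\<close>.\<close>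
  define A1 where "A1 = (\<lambda>(H :: real mat, h :: nat \<Rightarrow> real). mat n n (\<lambda>ij. H $$ ij))"
  define B1 where "B1 = (\<lambda>(H :: real mat, h). sparse_mat n m M S h)"
  define \<delta>A where "\<delta>A = (\<lambda>\<eta> u. \<eta> \<cdot>\<^sub>m A1 u)"
  define \<delta>B where "\<delta>B = (\<lambda>\<eta> u. \<eta> \<cdot>\<^sub>m B1 u)"
  have A1: "A1 u \<in> carrier_mat n n" for u by (simp add: A1_def split: prod.split)
  have B1: "B1 u \<in> carrier_mat n m" for u by (simp add: B1_def sparse_mat_carrier split: prod.split)
  have A1_U: "A1 (H, h) = H" if "H \<in> carrier_mat n n" for H h
    using that by (auto simp: A1_def)
  obtain KB where KB: "0 \<le> KB"
      "\<And>h. rel_bounded {1..M} 1 h \<omega> \<Longrightarrow> max_norm (sparse_mat n m M S h) \<le> KB"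
    using max_norm_sparse_mat_bounded[OF n m] by blast
  define KA where "KA = max_norm A"
  have KA: "0 \<le> KA" using max_norm_nonneg[OF A n n] by (simp add: KA_def)
  define L where "L = (SUP u\<in>U. ereal (max_norm (G * (B1 u - A1 u * X)) / max_norm X))"
  have "((\<lambda>\<eta>. Sup {ereal (1 / \<eta> * (max_norm D / max_norm X)) | D u. u \<in> U \<and>
      D \<in> carrier_mat n m \<and> (A + \<delta>A \<eta> u) * (X + D) = A * X + \<delta>B \<eta> u}) \<longlongrightarrow> L) (at_right 0)"
    unfolding L_def
  proof (rule perturbed_system_limit[OF n m A G X, where K = "KA + KB"], goal_cases)
    case (6 u)
    then obtain H h where u: "u = (H, h)" "H \<in> carrier_mat n n" "mat_rel_bounded 1 H A"
      by (auto simp: U_def)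
    have "\<bar>H $$ (i, j)\<bar> \<le> KA" if "i < n" "j < n" for i j
      using u(3) that A entry_le_max_norm[OF A that] by (fastforce simp: mat_rel_bounded_def KA_def)
    then have "max_norm (A1 u) \<le> KA"
      using u A1_U max_norm_le_iff[OF u(2) n n] by simp
    then show ?case using KB by simp
  next
    case (7 u)
    then have "max_norm (B1 u) \<le> KB" using KB by (auto simp: U_def B1_def)
    then show ?case using KA by simp
  next
    case (8 \<eta> u)
    have "max_norm (\<delta>A \<eta> u - \<eta> \<cdot>\<^sub>m A1 u) \<le> 0"
      using n A1[of u] by (subst max_norm_le_iff[of _ n n]) (auto simp: \<delta>A_def)
    moreover have "0 \<le> (KA + KB) * \<eta>\<^sup>2" using KA KB by simp
    ultimately show ?case by linarith
  next
    case (9 \<eta> u)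
    have "max_norm (\<delta>B \<eta> u - \<eta> \<cdot>\<^sub>m B1 u) \<le> 0"
      using n m B1[of u] by (subst max_norm_le_iff[of _ n m]) (auto simp: \<delta>B_def)
    moreover have "0 \<le> (KA + KB) * \<eta>\<^sup>2" using KA KB by simp
    ultimately show ?case by linarith
  qed (use KA KB A1 B1 in \<open>auto simp: \<delta>A_def \<delta>B_def\<close>)
  moreover have "eventually (\<lambda>\<eta>. Sup {ereal (1 / \<eta> * (max_norm D / max_norm X)) | D u. u \<in> U \<and>
      D \<in> carrier_mat n m \<and> (A + \<delta>A \<eta> u) * (X + D) = A * X + \<delta>B \<eta> u} =
      Sup (entrywise_quotients n m M S A \<omega> X \<eta>)) (at_right 0)"
    using eventually_at_right_less
  proof (rule eventually_mono, goal_cases)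
    case (1 \<eta>)
    have B_eq: "A * X + \<delta>B \<eta> (H, h) = sparse_mat n m M S (\<lambda>k. \<omega> k + \<eta> * h k)" for H h
      by (simp add: \<delta>B_def B1_def sol sparse_mat_add sparse_mat_smult)
    have A_eq: "A + \<delta>A \<eta> (H, h) = A + \<eta> \<cdot>\<^sub>m H" if "H \<in> carrier_mat n n" for H h
      using A1_U[OF that] by (simp add: \<delta>A_def)
    have scale: "(\<exists>H. H \<in> carrier_mat n n \<and> mat_rel_bounded 1 H A \<and> Q (\<eta> \<cdot>\<^sub>m H)) \<longleftrightarrow>
        (\<exists>H. H \<in> carrier_mat n n \<and> mat_rel_bounded \<eta> H A \<and> Q H)" for Q
    proof
      assume "\<exists>H. H \<in> carrier_mat n n \<and> mat_rel_bounded 1 H A \<and> Q (\<eta> \<cdot>\<^sub>m H)"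
      then obtain H where "H \<in> carrier_mat n n" "mat_rel_bounded 1 H A" "Q (\<eta> \<cdot>\<^sub>m H)" by blast
      then show "\<exists>H. H \<in> carrier_mat n n \<and> mat_rel_bounded \<eta> H A \<and> Q H"
        using mat_rel_bounded_scale[OF 1 A] by (intro exI[of _ "\<eta> \<cdot>\<^sub>m H"]) simp
    next
      assume "\<exists>H. H \<in> carrier_mat n n \<and> mat_rel_bounded \<eta> H A \<and> Q H"
      then obtain H where H: "H \<in> carrier_mat n n" "mat_rel_bounded \<eta> H A" "Q H" by blast
      have "\<eta> \<cdot>\<^sub>m ((1 / \<eta>) \<cdot>\<^sub>m H) = H" using 1 by (intro eq_matI) auto
      moreover have "(1 / \<eta>) \<cdot>\<^sub>m H \<in> carrier_mat n n" using H by simp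
      ultimately show "\<exists>H. H \<in> carrier_mat n n \<and> mat_rel_bounded 1 H A \<and> Q (\<eta> \<cdot>\<^sub>m H)"
        using H mat_rel_bounded_scale[OF 1 A, of "(1 / \<eta>) \<cdot>\<^sub>m H"]
        by (intro exI[of _ "(1 / \<eta>) \<cdot>\<^sub>m H"]) simp
    qed
    have "{ereal (1 / \<eta> * (max_norm D / max_norm X)) | D u. u \<in> U \<and>
        D \<in> carrier_mat n m \<and> (A + \<delta>A \<eta> u) * (X + D) = A * X + \<delta>B \<eta> u} =
      {s. \<exists>H. H \<in> carrier_mat n n \<and> mat_rel_bounded 1 H A \<and> (\<exists>h. rel_bounded {1..M} 1 h \<omega> \<and>
        (\<exists>D\<in>carrier_mat n m.
          (A + \<eta> \<cdot>\<^sub>m H) * (X + D) = sparse_mat n m M S (\<lambda>k. \<omega> k + \<eta> * h k) \<and>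
          s = ereal (1 / \<eta> * (max_norm D / max_norm X))))}" (is "_ = {s. ?R s}")
    proof (rule Collect_cong, rule iffI)
      fix s
      assume "\<exists>D u. s = ereal (1 / \<eta> * (max_norm D / max_norm X)) \<and> u \<in> U \<and>
        D \<in> carrier_mat n m \<and> (A + \<delta>A \<eta> u) * (X + D) = A * X + \<delta>B \<eta> u"
      then obtain D H h where *: "s = ereal (1 / \<eta> * (max_norm D / max_norm X))" "(H, h) \<in> U"
        "D \<in> carrier_mat n m" "(A + \<delta>A \<eta> (H, h)) * (X + D) = A * X + \<delta>B \<eta> (H, h)"
        by (metis surj_pair)
      then have "(A + \<eta> \<cdot>\<^sub>m H) * (X + D) = sparse_mat n m M S (\<lambda>k. \<omega> k + \<eta> * h k)"
        using A_eq[of H h] B_eq[of H h] by (simp add: U_def)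
      then show "?R s" using * unfolding U_def by blast
    next
      fix s assume "?R s"
      then obtain H h D where *: "H \<in> carrier_mat n n" "mat_rel_bounded 1 H A"
        "rel_bounded {1..M} 1 h \<omega>" "D \<in> carrier_mat n m"
        "(A + \<eta> \<cdot>\<^sub>m H) * (X + D) = sparse_mat n m M S (\<lambda>k. \<omega> k + \<eta> * h k)"
        "s = ereal (1 / \<eta> * (max_norm D / max_norm X))" by blast
      have "(A + \<delta>A \<eta> (H, h)) * (X + D) = A * X + \<delta>B \<eta> (H, h)"
        unfolding A_eq[OF *(1)] B_eq by (rule *(5))
      moreover have "(H, h) \<in> U" using * by (simp add: U_def)
      ultimately show "\<exists>D u. s = ereal (1 / \<eta> * (max_norm D / max_norm X)) \<and> u \<in> U \<and>
        D \<in> carrier_mat n m \<and> (A + \<delta>A \<eta> u) * (X + D) = A * X + \<delta>B \<eta> u"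
        using *(4,6) by blast
    qed
    also have "\<dots> =
      {s. \<exists>H. H \<in> carrier_mat n n \<and> mat_rel_bounded \<eta> H A \<and> (\<exists>h. rel_bounded {1..M} \<eta> h \<omega> \<and>
        (\<exists>D\<in>carrier_mat n m.
          (A + H) * (X + D) = sparse_mat n m M S (\<lambda>k. \<omega> k + h k) \<and>
          s = ereal (1 / \<eta> * (max_norm D / max_norm X))))}"
      unfolding ex_rel_bounded_scale[OF 1] scale[symmetric] ..
    also have "\<dots> = entrywise_quotients n m M S A \<omega> X \<eta>"
      unfolding entrywise_quotients_def by blast
    finally show ?case by simp
  qed
  ultimately have "((\<lambda>\<eta>. Sup (entrywise_quotients n m M S A \<omega> X \<eta>)) \<longlongrightarrow> L) (at_right 0)"
    by (rule Lim_transform_eventually)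
  then show ?thesis
    unfolding cond_entrywise_eq_Lim by (simp add: tendsto_Lim)
qed

text \<open>
  Admissible perturbations of the parameters are admissible entrywise perturbations at the larger
  radius \<open>\<eta>'\<close>; the factor \<open>\<eta>' / \<eta>\<close> accounts for the different scaling of the quotients.
\<close>

lemma Sup_qs_quotients_le:
  fixes n :: nat and \<eta> :: real
  defines "\<eta>' \<equiv> (1 + \<eta>) ^ n - 1"
  assumes n: "0 < n" and \<eta>: "0 < \<eta>"
  shows "Sup (qs_quotients n m M S \<Omega> \<omega> X \<eta>)
    \<le> ereal (\<eta>' / \<eta>) * Sup (entrywise_quotients n m M S (qs_mat n \<Omega>) \<omega> X \<eta>')"
proof (rule Sup_least)
  have le: "\<eta> \<le> \<eta>'"
    using power_increasing[of 1 n "1 + \<eta>"] n \<eta> by (simp add: \<eta>'_def)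
  fix s assume "s \<in> qs_quotients n m M S \<Omega> \<omega> X \<eta>"
  then obtain D \<delta>\<Omega> \<delta>\<omega> where s: "s = ereal (1 / \<eta> * (max_norm D / max_norm X))"
    and D: "D \<in> carrier_mat n m"
    and sol: "qs_mat n (\<lambda>x. \<Omega> x + \<delta>\<Omega> x) * (X + D) = sparse_mat n m M S (\<lambda>k. \<omega> k + \<delta>\<omega> k)"
    and rb: "rel_bounded (qs_indices n) \<eta> \<delta>\<Omega> \<Omega>" "rel_bounded {1..M} \<eta> \<delta>\<omega> \<omega>"
    unfolding qs_quotients_def by blast
  define H where "H = qs_mat n (\<lambda>x. \<Omega> x + \<delta>\<Omega> x) - qs_mat n \<Omega>"
  have H: "H \<in> carrier_mat n n" unfolding H_def by (rule minus_carrier_mat[OF qs_mat_carrier])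
  have "qs_mat n \<Omega> + H = qs_mat n (\<lambda>x. \<Omega> x + \<delta>\<Omega> x)"
    by (rule eq_matI) (auto simp: H_def qs_mat_def)
  moreover have "mat_rel_bounded \<eta>' H (qs_mat n \<Omega>)"
    using qs_mat_rel_perturbation[OF rb(1)] \<eta> by (simp add: H_def \<eta>'_def)
  moreover have "rel_bounded {1..M} \<eta>' \<delta>\<omega> \<omega>"
    using rb(2) mult_right_mono[OF le abs_ge_zero] unfolding rel_bounded_def
    by (meson order_trans)
  ultimately have mem: "ereal (1 / \<eta>' * (max_norm D / max_norm X))
      \<in> entrywise_quotients n m M S (qs_mat n \<Omega>) \<omega> X \<eta>'"
    unfolding entrywise_quotients_def using D H sol
    by (intro CollectI exI[of _ D] exI[of _ H] exI[of _ \<delta>\<omega>]) simp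
  have "s = ereal (\<eta>' / \<eta>) * ereal (1 / \<eta>' * (max_norm D / max_norm X))"
    using s \<eta> le by simp
  also have "\<dots> \<le> ereal (\<eta>' / \<eta>) * Sup (entrywise_quotients n m M S (qs_mat n \<Omega>) \<omega> X \<eta>')"
    using \<eta> le by (intro ereal_mult_left_mono Sup_upper mem) simp
  finally show "s \<le> \<dots>" .
qed

theorem proposition5p1:
  fixes n m M :: nat
    and A B X :: "real mat"
    and S :: "nat \<Rightarrow> real mat"
    and \<Omega> :: "qs_index \<Rightarrow> real"
    and \<omega> :: "nat \<Rightarrow> real"
  assumes "n \<ge> 2" and "m \<ge> 1"
    and "A \<in> carrier_mat n n" and "B \<in> carrier_mat n m" and "X \<in> carrier_mat n m"
    and "\<And>k. k \<in> {1..M} \<Longrightarrow> S k \<in> carrier_mat n m"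
    and "invertible_mat A"
    and "quasiseparable_1_1 n A"
    and "B = sparse_mat n m M S \<omega>"
    and "A * X = B"
    and "\<And>i j. i < n \<Longrightarrow> j < m \<Longrightarrow> X $$ (i, j) \<noteq> 0"
    and "qs_representation n A \<Omega>"
  shows "cond_qs n m M S \<Omega> \<omega> X \<le> ereal (real n) * cond_entrywise n m M S A \<omega> X"
proof -
  have n: "0 < n" and m: "0 < m" using assms(1,2) by auto
  have A: "A = qs_mat n \<Omega>" using assms(12) by (simp add: qs_representation_def)
  have sol: "A * X = sparse_mat n m M S \<omega>" using assms(9,10) by simp
  obtain G where "inverts_mat A G" "inverts_mat G A"
    using assms(7) by (auto simp: invertible_mat_def)
  then have G: "G \<in> carrier_mat n n" "G * A = 1\<^sub>m n"
    using assms(3) unfolding inverts_mat_def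
    by (metis carrier_matD carrier_matI index_mult_mat(2,3) index_one_mat(2,3))+
  \<comment> \<open>The radius at which the entrywise problem contains the quasiseparable one at radius \<open>\<eta>\<close>.\<close>
  define \<phi> where "\<phi> = (\<lambda>\<eta>::real. (1 + \<eta>) ^ n - 1)"
  have deriv: "(\<phi> has_real_derivative real n) (at 0)"
    unfolding \<phi>_def by (auto intro!: derivative_eq_intros)
  have "((\<lambda>\<eta>. \<phi> \<eta> / \<eta>) \<longlongrightarrow> real n) (at 0)"
    using deriv unfolding has_field_derivative_iff by (simp add: \<phi>_def)
  then have quot: "((\<lambda>\<eta>. \<phi> \<eta> / \<eta>) \<longlongrightarrow> real n) (at_right 0)"
    by (rule tendsto_within_subset) simp
  have "filterlim \<phi> (at_right 0) (at_right 0)"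
    unfolding filterlim_at
  proof
    have "(\<phi> \<longlongrightarrow> (1 + 0) ^ n - 1) (at_right 0)"
      unfolding \<phi>_def by (intro tendsto_intros)
    then show "(\<phi> \<longlongrightarrow> 0) (at_right 0)" by simp
    show "eventually (\<lambda>\<eta>. \<phi> \<eta> \<in> {0<..} \<and> \<phi> \<eta> \<noteq> 0) (at_right 0)"
      using eventually_at_right_less
    proof (rule eventually_mono)
      fix \<eta> :: real assume "0 < \<eta>"
      then have "1 < (1 + \<eta>) ^ n" using n by (simp add: one_less_power)
      then show "\<phi> \<eta> \<in> {0<..} \<and> \<phi> \<eta> \<noteq> 0" by (simp add: \<phi>_def)
    qed
  qed
  then have "((\<lambda>\<eta>. Sup (entrywise_quotients n m M S A \<omega> X (\<phi> \<eta>)))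
      \<longlongrightarrow> cond_entrywise n m M S A \<omega> X) (at_right 0)"
    by (rule filterlim_compose[OF tendsto_cond_entrywise[OF n m assms(3,5) G sol]])
  then have "((\<lambda>\<eta>. ereal (\<phi> \<eta> / \<eta>) * Sup (entrywise_quotients n m M S A \<omega> X (\<phi> \<eta>)))
      \<longlongrightarrow> ereal (real n) * cond_entrywise n m M S A \<omega> X) (at_right 0)"
    using quot n by (intro tendsto_mult_ereal tendsto_ereal) auto
  moreover have "((\<lambda>\<eta>. Sup (qs_quotients n m M S \<Omega> \<omega> X \<eta>)) \<longlongrightarrow> cond_qs n m M S \<Omega> \<omega> X) (at_right 0)"
    using tendsto_cond_qs[OF n m assms(5)] G sol A by simp
  moreover have "eventually (\<lambda>\<eta>. Sup (qs_quotients n m M S \<Omega> \<omega> X \<eta>)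
      \<le> ereal (\<phi> \<eta> / \<eta>) * Sup (entrywise_quotients n m M S A \<omega> X (\<phi> \<eta>))) (at_right 0)"
    using eventually_at_right_less
    by (rule eventually_mono) (use Sup_qs_quotients_le[OF n] in \<open>simp add: \<phi>_def A\<close>)
  ultimately show ?thesis
    by (intro tendsto_le[OF trivial_limit_at_right_real])
qed

end
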